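(* Each of the first-order theories $VW^+$, $VW^*$, $VW_0$ and $VWDI$ (defined in the context) is essentially undecidable.
   Context: A theory is essentially undecidable if it is consistent and every consistent extension of it in the same language is undecidable. All theories below also include the usual axioms for identity. Strings: $\Sigma^*$ is the set of finite words over $\{1,2\}$, including the empty word $e$; $^\frown$ is concatenation; $lh(s)$ is the length of $s$; $s^{-1}$ is the reversal of $s$; $s\sqsubseteq t$ between strings means $s$ is an initial segment of $t$ (not necessarily proper), $s\sqsupseteq t$ means $s$ is an end segment of $t$ (so $t=u^\frown s$ for some $u$). $D=\{1,2\}$. The same symbols $\sqsubseteq,\sqsupseteq$ are used for binary relation symbols. Canonical terms (for signatures with constant $\underline{e}$ and unary function symbols $S_1,S_2$): for $e$ it is $\underline{e}$, and $\underline{w^\frown d}$ is $S_d(\underline{w})$ for $d\in D$. $2^m$ is the string of $m$ consecutive 2's ($2^0=e$). $VW^+$: signature $\{\underline{e},S_1,S_2,f,\sqsubseteq,|{\le}|\}$ ($S_1,S_2,f$ unary functions, $\sqsubseteq,|{\le}|$ binary relations). Axioms: (VW1) $\neg\,\underline{s}=\underline{t}$ for distinct $s,t\in\Sigma^*$; (VW2) $S_d(\underline{t})=\underline{t^\frown d}$ for $t\in\Sigma^*$, $d=1,2$; (VW3) $\underline{e}\sqsubseteq\underline{t}$ for $t\in\Sigma^*$; (VW4) $\forall x(x\sqsubseteq\underline{e}\to x=\underline{e})$; (VW5) $\forall x(x\sqsubseteq S_d(\underline{t})\leftrightarrow x\sqsubseteq\underline{t}\vee x=S_d(\underline{t}))$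 for $t\in\Sigma^*$, $d=1,2$; (VW6) $\forall x(x\,|{\le}|\,\underline{2^m}\leftrightarrow\bigvee_{lh(s)\le m}x=\underline{s})$ for $m\ge0$; (VW7) $\exists y\,(y\,|{\le}|\,\underline{t})\to\forall x(x\sqsubseteq\underline{t}\ \&\ x\ne\underline{e}\to\underline{2}\sqsubseteq f(x))$ for $t\in\Sigma^*$; (VW8) $f(\underline{t})=\underline{t^{-1}}$ for $t\in\Sigma^*$; (VW9) $\forall x,y(f(x)=f(y)\to x=y)$; (VW10) $\forall x,y(x\sqsubseteq y\ \&\ y\sqsubseteq x\to x=y)$. $VW^*$: signature $\{\underline{e},S_1,S_2,S_3,S_4,\sqsubseteq,\sqsupseteq\}$ ($S_i$ unary functions). Axioms: (VW1)–(VW5), (VW10), and (VW2* ) $S_3(\underline{t})=\underline{1^\frown t}$ and $S_4(\underline{t})=\underline{2^\frown t}$ for $t\in\Sigma^*$; (VW3* ) $\underline{e}\sqsupseteq\underline{t}$ for $t\in\Sigma^*$; (VW4* ) $\forall x(x\sqsupseteq\underline{e}\to x=\underline{e})$; (VW5* ) $\forall x(x\sqsupseteq S_d(\underline{t})\leftrightarrow x\sqsupseteq\underline{t}\vee x=S_d(\underline{t}))$ for $t\in\Sigma^*$, $d=3,4$. $VW_0$: signature consisting of a constant $\underline{s}$ for each $s\in\Sigma^*$ and the binary relation symbols $\sqsubseteq,\sqsupseteq$. Write $x\sqsubset y$ for $x\sqsubseteq y\ \&\ x\ne y$ and $x\sqsupset y$ for $x\sqsupseteq y\ \&\ x\neq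 y$. Axioms: ($VW_0$1) $\neg\,\underline{s}=\underline{t}$ for distinct $s,t\in\Sigma^*$; ($VW_0$2) $\forall x(x\sqsubseteq\underline{t}\leftrightarrow\bigvee_{s\sqsubseteq t}x=\underline{s})$ for $t\in\Sigma^*$; ($VW_0$3) $\forall x(x\sqsupseteq\underline{t}\leftrightarrow\bigvee_{s\sqsupseteq t}x=\underline{s})$ for $t\in\Sigma^*$; ($VW_0$4) $\forall x\big(\forall y(y\sqsubset x\leftrightarrow y\sqsubset\underline{t})\to\bigwedge_{d\in D}(\underline{d}\sqsupseteq x\ \&\ \underline{d}\sqsupseteq\underline{t}\to x=\underline{t})\big)$ for $t\in\Sigma^*$; ($VW_0$5) $\forall x\big(\forall y(y\sqsupset x\leftrightarrow y\sqsupset\underline{t})\to\bigwedge_{d\in D}(\underline{d}\sqsubseteq x\ \&\ \underline{d}\sqsubseteq\underline{t}\to x=\underline{t})\big)$ for $t\in\Sigma^*$; and (VW10). $VWDI$: signature consisting of a constant $\underline{s}$ for each $s\in\Sigma^*$, a unary function symbol $f$ and a binary relation symbol $\sqsubseteq$. Axioms: (VWDI1) $\neg\,\underline{s}=\underline{t}$ for distinct $s,t\in\Sigma^*$; (VWDI2) $f(\underline{s})=\underline{s^{-1}}$ for $s\in\Sigma^*$; (VWDI3) $\forall x(x\sqsubseteq\underline{t}\leftrightarrow\bigvee_{s\sqsubseteq t}x=\underline{s})$ for $t\in\Sigma^*$; (VWDI4) $\forall x\,f(f(x))=x$; (VWDI5) $\forall x\big(\forall y(y\sqsubset x\leftrightarrow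 y\sqsubset\underline{t})\to\bigwedge_{d\in D}(\underline{d}\sqsubseteq f(x)\ \&\ \underline{d}\sqsubseteq f(\underline{t})\to x=\underline{t})\big)$ for $t\in\Sigma^*$; and (VW10). *)

theory Defs
  imports Main "HOL-Library.Sublist" "HOL-Library.Nat_Bijection"
begin

section \<open>Strings over the alphabet 1, 2\<close>

text \<open>Concatenation, length, reversal, initial segments and end segments of strings are
  \<open>@\<close>, \<open>length\<close>, \<open>rev\<close>, \<open>prefix\<close> and \<open>suffix\<close>.\<close>

datatype digit = One | Two

type_synonym str = "digit list"

definition strings_upto :: "nat \<Rightarrow> str list" where
  "strings_upto m = concat (map (\<lambda>k. List.n_lists k [One, Two]) [0..<Suc m])"

lemma UNIV_digit: "(UNIV :: digit set) = {One, Two}"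
  using digit.exhaust by blast

lemma set_strings_upto: "set (strings_upto m) = {s. length s \<le> m}"
proof -
  have "set s \<subseteq> {One, Two}" for s :: str
    by (metis UNIV_digit subset_UNIV)
  then show ?thesis
    by (auto simp: strings_upto_def set_n_lists less_Suc_eq_le)
qed


section \<open>First-order logic with identity\<close>

text \<open>All the languages considered have only constants, unary function symbols and binary
  relation symbols. Symbols are drawn from a common stock and a language is a choice of
  symbols from it. Variables are de Bruijn indices. The other connectives are the usual
  classical abbreviations.\<close>

datatype funsym = S1 | S2 | S3 | S4 | F

datatype relsym = Init | End | LenLe

datatype tm = Var nat | Const str | App funsym tm

datatype fm = Bot | Eq tm tm | Rel relsym tm tm | Imp fm fm | All fm

abbreviation Neg :: "fm \<Rightarrow> fm" where "Neg p \<equiv> Imp p Bot"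
abbreviation Con :: "fm \<Rightarrow> fm \<Rightarrow> fm" where "Con p q \<equiv> Neg (Imp p (Neg q))"
abbreviation Dis :: "fm \<Rightarrow> fm \<Rightarrow> fm" where "Dis p q \<equiv> Imp (Neg p) q"
abbreviation Iff :: "fm \<Rightarrow> fm \<Rightarrow> fm" where "Iff p q \<equiv> Con (Imp p q) (Imp q p)"
abbreviation Ex :: "fm \<Rightarrow> fm" where "Ex p \<equiv> Neg (All (Neg p))"

fun big_dis :: "fm list \<Rightarrow> fm" where
  "big_dis [] = Bot"
| "big_dis [p] = p"
| "big_dis (p # ps) = Dis p (big_dis ps)"

record lang =
  consts_of :: "str set"
  funs_of :: "funsym set"
  rels_of :: "relsym set"

primrec tm_in :: "lang \<Rightarrow> tm \<Rightarrow> bool" where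
  "tm_in L (Var i) \<longleftrightarrow> True"
| "tm_in L (Const s) \<longleftrightarrow> s \<in> consts_of L"
| "tm_in L (App g t) \<longleftrightarrow> g \<in> funs_of L \<and> tm_in L t"

primrec fm_in :: "lang \<Rightarrow> fm \<Rightarrow> bool" where
  "fm_in L Bot \<longleftrightarrow> True"
| "fm_in L (Eq s t) \<longleftrightarrow> tm_in L s \<and> tm_in L t"
| "fm_in L (Rel R s t) \<longleftrightarrow> R \<in> rels_of L \<and> tm_in L s \<and> tm_in L t"
| "fm_in L (Imp p q) \<longleftrightarrow> fm_in L p \<and> fm_in L q"
| "fm_in L (All p) \<longleftrightarrow> fm_in L p"

text \<open>\<open>tm_below n\<close>, \<open>fm_below n\<close>: all free indices are smaller than \<open>n\<close>.\<close>

primrec tm_below :: "nat \<Rightarrow> tm \<Rightarrow> bool" where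
  "tm_below n (Var i) \<longleftrightarrow> i < n"
| "tm_below n (Const s) \<longleftrightarrow> True"
| "tm_below n (App g t) \<longleftrightarrow> tm_below n t"

primrec fm_below :: "nat \<Rightarrow> fm \<Rightarrow> bool" where
  "fm_below n Bot \<longleftrightarrow> True"
| "fm_below n (Eq s t) \<longleftrightarrow> tm_below n s \<and> tm_below n t"
| "fm_below n (Rel R s t) \<longleftrightarrow> tm_below n s \<and> tm_below n t"
| "fm_below n (Imp p q) \<longleftrightarrow> fm_below n p \<and> fm_below n q"
| "fm_below n (All p) \<longleftrightarrow> fm_below (Suc n) p"

definition sentences :: "lang \<Rightarrow> fm set" where
  "sentences L = {p. fm_in L p \<and> fm_below 0 p}"

primrec lift_tm :: "nat \<Rightarrow> tm \<Rightarrow> tm" where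
  "lift_tm k (Var i) = (if i < k then Var i else Var (Suc i))"
| "lift_tm k (Const s) = Const s"
| "lift_tm k (App g t) = App g (lift_tm k t)"

primrec lift_fm :: "nat \<Rightarrow> fm \<Rightarrow> fm" where
  "lift_fm k Bot = Bot"
| "lift_fm k (Eq s t) = Eq (lift_tm k s) (lift_tm k t)"
| "lift_fm k (Rel R s t) = Rel R (lift_tm k s) (lift_tm k t)"
| "lift_fm k (Imp p q) = Imp (lift_fm k p) (lift_fm k q)"
| "lift_fm k (All p) = All (lift_fm (Suc k) p)"

primrec subst_tm :: "nat \<Rightarrow> tm \<Rightarrow> tm \<Rightarrow> tm" where
  "subst_tm k u (Var i) = (if i < k then Var i else if i = k then u else Var (i - 1))"
| "subst_tm k u (Const s) = Const s"
| "subst_tm k u (App g t) = App g (subst_tm k u t)"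

primrec subst_fm :: "nat \<Rightarrow> tm \<Rightarrow> fm \<Rightarrow> fm" where
  "subst_fm k u Bot = Bot"
| "subst_fm k u (Eq s t) = Eq (subst_tm k u s) (subst_tm k u t)"
| "subst_fm k u (Rel R s t) = Rel R (subst_tm k u s) (subst_tm k u t)"
| "subst_fm k u (Imp p q) = Imp (subst_fm k u p) (subst_fm k u q)"
| "subst_fm k u (All p) = All (subst_fm (Suc k) (lift_tm 0 u) p)"

text \<open>Classical natural deduction in the language \<open>L\<close>. The axioms for identity, which every
  theory is understood to include, are supplied by the last two rules.\<close>

inductive proves :: "lang \<Rightarrow> fm set \<Rightarrow> fm \<Rightarrow> bool" for L where
  Assm: "p \<in> G \<Longrightarrow> fm_in L p \<Longrightarrow> proves L G p"
| ImpI: "fm_in L p \<Longrightarrow> proves L (insert p G) q \<Longrightarrow> proves L G (Imp p q)"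
| ImpE: "proves L G (Imp p q) \<Longrightarrow> proves L G p \<Longrightarrow> proves L G q"
| Raa: "fm_in L p \<Longrightarrow> proves L (insert (Neg p) G) Bot \<Longrightarrow> proves L G p"
| AllI: "proves L (lift_fm 0 ` G) p \<Longrightarrow> proves L G (All p)"
| AllE: "tm_in L t \<Longrightarrow> proves L G (All p) \<Longrightarrow> proves L G (subst_fm 0 t p)"
| Refl: "tm_in L t \<Longrightarrow> proves L G (Eq t t)"
| Leibniz: "fm_in L p \<Longrightarrow> proves L G (Eq s t) \<Longrightarrow> proves L G (subst_fm 0 s p)
    \<Longrightarrow> proves L G (subst_fm 0 t p)"

definition theorems :: "lang \<Rightarrow> fm set \<Rightarrow> fm set" where
  "theorems L T = {p \<in> sentences L. proves L T p}"

definition consistent :: "lang \<Rightarrow> fm set \<Rightarrow> bool" where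
  "consistent L T \<longleftrightarrow> \<not> proves L T Bot"


section \<open>Decidability\<close>

text \<open>\<open>recursive n f\<close>: the restriction of \<open>f\<close> to lists of length \<open>n\<close> is an \<open>n\<close>-ary total
  recursive function; values of \<open>f\<close> on other lists are irrelevant. Minimization is applied
  to regular functions only.\<close>

inductive recursive :: "nat \<Rightarrow> (nat list \<Rightarrow> nat) \<Rightarrow> bool" where
  zero: "recursive n (\<lambda>xs. 0)"
| succ: "recursive 1 (\<lambda>xs. Suc (xs ! 0))"
| proj: "i < n \<Longrightarrow> recursive n (\<lambda>xs. xs ! i)"
| comp: "recursive (length gs) f \<Longrightarrow> (\<And>g. g \<in> set gs \<Longrightarrow> recursive n g)
    \<Longrightarrow> recursive n (\<lambda>xs. f (map (\<lambda>g. g xs) gs))"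
| prec: "recursive n f \<Longrightarrow> recursive (Suc (Suc n)) g
    \<Longrightarrow> recursive (Suc n) (\<lambda>xs. rec_nat (f (tl xs)) (\<lambda>k r. g (k # r # tl xs)) (hd xs))"
| mu: "recursive (Suc n) f \<Longrightarrow> (\<And>xs. length xs = n \<Longrightarrow> \<exists>y. f (y # xs) = 0)
    \<Longrightarrow> recursive n (\<lambda>xs. LEAST y. f (y # xs) = 0)"

definition decidable_set :: "nat set \<Rightarrow> bool" where
  "decidable_set A \<longleftrightarrow> (\<exists>f. recursive 1 f \<and> (\<forall>n. f [n] = (if n \<in> A then 1 else 0)))"

primrec digit_code :: "digit \<Rightarrow> nat" where
  "digit_code One = 1"
| "digit_code Two = 2"

primrec fun_code :: "funsym \<Rightarrow> nat" where
  "fun_code S1 = 0"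
| "fun_code S2 = 1"
| "fun_code S3 = 2"
| "fun_code S4 = 3"
| "fun_code F = 4"

primrec rel_code :: "relsym \<Rightarrow> nat" where
  "rel_code Init = 0"
| "rel_code End = 1"
| "rel_code LenLe = 2"

primrec tm_code :: "tm \<Rightarrow> nat" where
  "tm_code (Var i) = prod_encode (0, i)"
| "tm_code (Const s) = prod_encode (1, list_encode (map digit_code s))"
| "tm_code (App g t) = prod_encode (2, prod_encode (fun_code g, tm_code t))"

primrec fm_code :: "fm \<Rightarrow> nat" where
  "fm_code Bot = prod_encode (0, 0)"
| "fm_code (Eq s t) = prod_encode (1, prod_encode (tm_code s, tm_code t))"
| "fm_code (Rel R s t) =
    prod_encode (2, prod_encode (rel_code R, prod_encode (tm_code s, tm_code t)))"
| "fm_code (Imp p q) = prod_encode (3, prod_encode (fm_code p, fm_code q))"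
| "fm_code (All p) = prod_encode (4, fm_code p)"

lemma tm_code_inj: "tm_code s = tm_code t \<Longrightarrow> s = t"
proof (induction s arbitrary: t)
  case (Const s)
  have "inj digit_code"
  proof (rule injI)
    fix x y assume "digit_code x = digit_code y"
    then show "x = y" by (cases x; cases y) simp_all
  qed
  with Const show ?case by (cases t) (auto simp: list_encode_eq inj_map_eq_map)
next
  case (App g s)
  have "fun_code g = fun_code h \<Longrightarrow> g = h" for h by (cases g; cases h) simp_all
  with App show ?case by (cases t) auto
qed (case_tac t; simp)

lemma fm_code_inj: "fm_code p = fm_code q \<Longrightarrow> p = q"
proof (induction p arbitrary: q)
  case (Rel R s t)
  have "rel_code R = rel_code R' \<Longrightarrow> R = R'" for R' by (cases R; cases R') simp_all
  with Rel show ?case by (cases q) (auto dest: tm_code_inj)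
qed (case_tac q; auto dest: tm_code_inj)+

definition decidable_theory :: "lang \<Rightarrow> fm set \<Rightarrow> bool" where
  "decidable_theory L T \<longleftrightarrow> decidable_set (fm_code ` theorems L T)"

definition essentially_undecidable :: "lang \<Rightarrow> fm set \<Rightarrow> bool" where
  "essentially_undecidable L T \<longleftrightarrow>
     consistent L T \<and>
     (\<forall>T' \<subseteq> sentences L.
        theorems L T \<subseteq> theorems L T' \<and> consistent L T' \<longrightarrow> \<not> decidable_theory L T')"


section \<open>The theories\<close>

primrec S_right :: "digit \<Rightarrow> funsym" where
  "S_right One = S1"
| "S_right Two = S2"

primrec S_left :: "digit \<Rightarrow> funsym" where
  "S_left One = S3"
| "S_left Two = S4"

text \<open>Canonical terms built from the constant for the empty string by \<open>S1\<close> and \<open>S2\<close>;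
  the outermost symbol corresponds to the last digit.\<close>

definition canon :: "str \<Rightarrow> tm" where
  "canon s = foldl (\<lambda>u d. App (S_right d) u) (Const []) s"

lemma canon_simps: "canon [] = Const []" "canon (s @ [d]) = App (S_right d) (canon s)"
  by (simp_all add: canon_def)

definition Proper :: "relsym \<Rightarrow> tm \<Rightarrow> tm \<Rightarrow> fm" where
  "Proper R s t = Con (Rel R s t) (Neg (Eq s t))"

definition VW1 :: "fm set" where
  "VW1 = {Neg (Eq (canon s) (canon t)) | s t. s \<noteq> t}"
definition VW2 :: "fm set" where
  "VW2 = {Eq (App (S_right d) (canon t)) (canon (t @ [d])) | t d. True}"
definition VW3 :: "fm set" where
  "VW3 = {Rel Init (canon []) (canon t) | t. True}"
definition VW4 :: "fm set" where
  "VW4 = {All (Imp (Rel Init (Var 0) (canon [])) (Eq (Var 0) (canon [])))}"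
definition VW5 :: "fm set" where
  "VW5 = {All (Iff (Rel Init (Var 0) (App (S_right d) (canon t)))
      (Dis (Rel Init (Var 0) (canon t)) (Eq (Var 0) (App (S_right d) (canon t))))) | t d. True}"
definition VW6 :: "fm set" where
  "VW6 = {All (Iff (Rel LenLe (Var 0) (canon (replicate m Two)))
      (big_dis (map (\<lambda>s. Eq (Var 0) (canon s)) (strings_upto m)))) | m. True}"
definition VW7 :: "fm set" where
  "VW7 = {Imp (Ex (Rel LenLe (Var 0) (canon t)))
      (All (Imp (Con (Rel Init (Var 0) (canon t)) (Neg (Eq (Var 0) (canon []))))
        (Rel Init (canon [Two]) (App F (Var 0))))) | t. True}"
definition VW8 :: "fm set" where
  "VW8 = {Eq (App F (canon t)) (canon (rev t)) | t. True}"
definition VW9 :: "fm set" where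
  "VW9 = {All (All (Imp (Eq (App F (Var 1)) (App F (Var 0))) (Eq (Var 1) (Var 0))))}"
definition VW10 :: "fm set" where
  "VW10 = {All (All (Imp (Con (Rel Init (Var 1) (Var 0)) (Rel Init (Var 0) (Var 1)))
      (Eq (Var 1) (Var 0))))}"

definition L_VW_plus :: lang where
  "L_VW_plus = \<lparr>consts_of = {[]}, funs_of = {S1, S2, F}, rels_of = {Init, LenLe}\<rparr>"
definition VW_plus :: "fm set" where
  "VW_plus = VW1 \<union> VW2 \<union> VW3 \<union> VW4 \<union> VW5 \<union> VW6 \<union> VW7 \<union> VW8 \<union> VW9 \<union> VW10"

definition VW2_star :: "fm set" where
  "VW2_star = {Eq (App (S_left d) (canon t)) (canon (d # t)) | t d. True}"
definition VW3_star :: "fm set" where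
  "VW3_star = {Rel End (canon []) (canon t) | t. True}"
definition VW4_star :: "fm set" where
  "VW4_star = {All (Imp (Rel End (Var 0) (canon [])) (Eq (Var 0) (canon [])))}"
definition VW5_star :: "fm set" where
  "VW5_star = {All (Iff (Rel End (Var 0) (App (S_left d) (canon t)))
      (Dis (Rel End (Var 0) (canon t)) (Eq (Var 0) (App (S_left d) (canon t))))) | t d. True}"

definition L_VW_star :: lang where
  "L_VW_star = \<lparr>consts_of = {[]}, funs_of = {S1, S2, S3, S4}, rels_of = {Init, End}\<rparr>"
definition VW_star :: "fm set" where
  "VW_star = VW1 \<union> VW2 \<union> VW3 \<union> VW4 \<union> VW5 \<union> VW10 \<union>
     VW2_star \<union> VW3_star \<union> VW4_star \<union> VW5_star"

text \<open>In the remaining two theories the name of a string \<open>s\<close> is the constant \<open>Const s\<close>.\<close>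

definition VW0_1 :: "fm set" where
  "VW0_1 = {Neg (Eq (Const s) (Const t)) | s t. s \<noteq> t}"
definition VW0_2 :: "fm set" where
  "VW0_2 = {All (Iff (Rel Init (Var 0) (Const t))
      (big_dis (map (\<lambda>s. Eq (Var 0) (Const s)) (prefixes t)))) | t. True}"
definition VW0_3 :: "fm set" where
  "VW0_3 = {All (Iff (Rel End (Var 0) (Const t))
      (big_dis (map (\<lambda>s. Eq (Var 0) (Const s)) (suffixes t)))) | t. True}"

definition VW0_4_conj :: "str \<Rightarrow> digit \<Rightarrow> fm" where
  "VW0_4_conj t d = Imp (Con (Rel End (Const [d]) (Var 0)) (Rel End (Const [d]) (Const t)))
     (Eq (Var 0) (Const t))"
definition VW0_4 :: "fm set" where
  "VW0_4 = {All (Imp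
      (All (Iff (Proper Init (Var 0) (Var 1)) (Proper Init (Var 0) (Const t))))
      (Con (VW0_4_conj t One) (VW0_4_conj t Two))) | t. True}"

definition VW0_5_conj :: "str \<Rightarrow> digit \<Rightarrow> fm" where
  "VW0_5_conj t d = Imp (Con (Rel Init (Const [d]) (Var 0)) (Rel Init (Const [d]) (Const t)))
     (Eq (Var 0) (Const t))"
definition VW0_5 :: "fm set" where
  "VW0_5 = {All (Imp
      (All (Iff (Proper End (Var 0) (Var 1)) (Proper End (Var 0) (Const t))))
      (Con (VW0_5_conj t One) (VW0_5_conj t Two))) | t. True}"

definition L_VW_0 :: lang where
  "L_VW_0 = \<lparr>consts_of = UNIV, funs_of = {}, rels_of = {Init, End}\<rparr>"
definition VW_0 :: "fm set" where
  "VW_0 = VW0_1 \<union> VW0_2 \<union> VW0_3 \<union> VW0_4 \<union> VW0_5 \<union> VW10"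

definition VWDI_2 :: "fm set" where
  "VWDI_2 = {Eq (App F (Const s)) (Const (rev s)) | s. True}"
definition VWDI_4 :: "fm set" where
  "VWDI_4 = {All (Eq (App F (App F (Var 0))) (Var 0))}"

definition VWDI_5_conj :: "str \<Rightarrow> digit \<Rightarrow> fm" where
  "VWDI_5_conj t d =
     Imp (Con (Rel Init (Const [d]) (App F (Var 0))) (Rel Init (Const [d]) (App F (Const t))))
       (Eq (Var 0) (Const t))"
definition VWDI_5 :: "fm set" where
  "VWDI_5 = {All (Imp
      (All (Iff (Proper Init (Var 0) (Var 1)) (Proper Init (Var 0) (Const t))))
      (Con (VWDI_5_conj t One) (VWDI_5_conj t Two))) | t. True}"

definition L_VWDI :: lang where
  "L_VWDI = \<lparr>consts_of = UNIV, funs_of = {F}, rels_of = {Init}\<rparr>"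

definition VWDI :: "fm set" where
  "VWDI = VW0_1 \<union> VWDI_2 \<union> VW0_2 \<union> VWDI_4 \<union> VWDI_5 \<union> VW10"


lemma big_dis_closed:
  "(\<And>p. p \<in> set ps \<Longrightarrow> fm_in L p \<and> fm_below n p) \<Longrightarrow>
   fm_in L (big_dis ps) \<and> fm_below n (big_dis ps)"
  by (induction ps rule: big_dis.induct) auto

lemma canon_closed:
  "{S1, S2} \<subseteq> funs_of L \<Longrightarrow> [] \<in> consts_of L \<Longrightarrow> tm_in L (canon s) \<and> tm_below n (canon s)"
proof (induction s rule: rev_induct)
  case (snoc d s)
  then show ?case by (cases d) (auto simp: canon_simps)
qed (simp add: canon_simps)

lemma theories_are_sentences:
  "VW_plus \<subseteq> sentences L_VW_plus" "VW_star \<subseteq> sentences L_VW_star"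
  "VW_0 \<subseteq> sentences L_VW_0" "VWDI \<subseteq> sentences L_VWDI"
proof -
  have c: "tm_in L_VW_plus (canon s)" "tm_in L_VW_star (canon s)" "tm_below n (canon s)" for s n
    using canon_closed[of L_VW_plus s n] canon_closed[of L_VW_star s n]
    by (auto simp: L_VW_plus_def L_VW_star_def)
  have f: "S_right d \<in> funs_of L_VW_plus" "S_right d \<in> funs_of L_VW_star"
    "S_left d \<in> funs_of L_VW_star" for d
    by (cases d; simp add: L_VW_plus_def L_VW_star_def)+
  have b: "fm_in L (big_dis (map (\<lambda>s. Eq (Var 0) (u s)) ss))"
    "fm_below (Suc 0) (big_dis (map (\<lambda>s. Eq (Var 0) (u s)) ss))"
    if "\<And>s. tm_in L (u s)" "\<And>s. tm_below (Suc 0) (u s)" for L ss and u :: "str \<Rightarrow> tm"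
  proof -
    have "fm_in L (big_dis (map (\<lambda>s. Eq (Var 0) (u s)) ss)) \<and>
        fm_below (Suc 0) (big_dis (map (\<lambda>s. Eq (Var 0) (u s)) ss))"
      by (rule big_dis_closed) (auto simp: that)
    then show "fm_in L (big_dis (map (\<lambda>s. Eq (Var 0) (u s)) ss))"
      "fm_below (Suc 0) (big_dis (map (\<lambda>s. Eq (Var 0) (u s)) ss))" by auto
  qed
  have L: "rels_of L_VW_plus = {Init, LenLe}" "rels_of L_VW_star = {Init, End}"
    "F \<in> funs_of L_VW_plus" by (simp_all add: L_VW_plus_def L_VW_star_def)
  show "VW_plus \<subseteq> sentences L_VW_plus"
    by (auto simp: VW_plus_def VW1_def VW2_def VW3_def VW4_def VW5_def VW6_def VW7_def VW8_def
        VW9_def VW10_def sentences_def c f L b[of L_VW_plus])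
  show "VW_star \<subseteq> sentences L_VW_star"
    by (auto simp: VW_star_def VW1_def VW2_def VW3_def VW4_def VW5_def VW10_def VW2_star_def
        VW3_star_def VW4_star_def VW5_star_def sentences_def c f L)
  show "VW_0 \<subseteq> sentences L_VW_0"
    by (auto simp: VW_0_def VW0_1_def VW0_2_def VW0_3_def VW0_4_def VW0_5_def VW10_def
        VW0_4_conj_def VW0_5_conj_def Proper_def sentences_def b(1)[where u = Const] b(2)[where L = L_VW_0 and u = Const] L_VW_0_def)
  show "VWDI \<subseteq> sentences L_VWDI"
    by (auto simp: VWDI_def VW0_1_def VW0_2_def VWDI_2_def VWDI_4_def VWDI_5_def VW10_def
        VWDI_5_conj_def Proper_def sentences_def b(1)[where u = Const] b(2)[where L = L_VWDI and u = Const] L_VWDI_def)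
qed

end

theory Submission
  imports Defs "HOL-Library.Countable_Set"
begin

text \<open>Four relations are definable in each of the theories: initial segment, end segment, and adding
  a given digit on the right or on the left; they are correct when the longer string is
  standard, and the last two also when the shorter one is. This suffices to represent every recursive function. For minimization the search walks
  up the initial segments of a unary numeral. For primitive recursion a finite table of values is
  coded by one string, and the required entry is justified by descending to index 0, so that nothing
  need be known about nonstandard tables. If a consistent extension were decidable, its decision
  procedure could be represented, and the sentence saying of itself that it is not a theorem would
  give a contradiction. Representability is proved in models, which the completeness theorem turns
  into provability.\<close>


section \<open>Semantics and soundness\<close>

text \<open>The obstacle is that the axioms describe little beyond the standard elements. No axiom
  makes an arbitrary element comparable with a standard string, and nothing prevents a successor
  function from sending a nonstandard element to a standard one. Hence adding a digit is always
  defined together with the demand that the shorter element be a segment of the longer one: whatever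
  is reached by descending from a standard element is then standard. \<open>VW_0\<close> and
  \<open>VWDI\<close> have no symbols for adding a digit; there the strict segments of the result
  must be the segments of the given element, and the schemes about equal strict segments make the
  result unique. In \<open>VW_plus\<close> and \<open>VWDI\<close> the left-hand relations are
  images of the right-hand ones under the injective reversal \<open>F\<close>. Both kinds of
  segments are needed because a factor of a string, hence an entry of a table, is an end segment of
  an initial segment. Models have the natural numbers as carrier, since a HOL formula cannot
  quantify over carrier types; as names of distinct strings are provably distinct, these models
  suffice for completeness.\<close>

record 'a struct =
  const_of :: "str \<Rightarrow> 'a"
  fun_of :: "funsym \<Rightarrow> 'a \<Rightarrow> 'a"
  rel_of :: "relsym \<Rightarrow> 'a \<Rightarrow> 'a \<Rightarrow> bool"

primrec eval_tm :: "'a struct \<Rightarrow> (nat \<Rightarrow> 'a) \<Rightarrow> tm \<Rightarrow> 'a" where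
  "eval_tm M e (Var i) = e i"
| "eval_tm M e (Const s) = const_of M s"
| "eval_tm M e (App g t) = fun_of M g (eval_tm M e t)"

primrec sat :: "'a struct \<Rightarrow> (nat \<Rightarrow> 'a) \<Rightarrow> fm \<Rightarrow> bool" where
  "sat M e Bot \<longleftrightarrow> False"
| "sat M e (Eq s t) \<longleftrightarrow> eval_tm M e s = eval_tm M e t"
| "sat M e (Rel R s t) \<longleftrightarrow> rel_of M R (eval_tm M e s) (eval_tm M e t)"
| "sat M e (Imp p q) \<longleftrightarrow> (sat M e p \<longrightarrow> sat M e q)"
| "sat M e (All p) \<longleftrightarrow> (\<forall>x. sat M (case_nat x e) p)"

definition models :: "'a struct \<Rightarrow> fm set \<Rightarrow> bool" where
  "models M T \<longleftrightarrow> (\<forall>p\<in>T. \<forall>e. sat M e p)"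

lemma sat_big_dis: "sat M e (big_dis ps) \<longleftrightarrow> (\<exists>p\<in>set ps. sat M e p)"
  by (induction ps rule: big_dis.induct) auto

lemma eval_tm_cong:
  "tm_below n t \<Longrightarrow> (\<And>i. i < n \<Longrightarrow> e i = e' i) \<Longrightarrow> eval_tm M e t = eval_tm M e' t"
  by (induction t) auto

lemma sat_cong:
  "fm_below n p \<Longrightarrow> (\<And>i. i < n \<Longrightarrow> e i = e' i) \<Longrightarrow> sat M e p \<longleftrightarrow> sat M e' p"
proof (induction p arbitrary: n e e')
  case (All p)
  have "sat M (case_nat x e) p \<longleftrightarrow> sat M (case_nat x e') p" for x
    using All.prems by (intro All.IH[where n = "Suc n"]) (auto split: nat.split)
  then show ?case by simp
next
  case (Imp p q)
  have "sat M e p \<longleftrightarrow> sat M e' p" "sat M e q \<longleftrightarrow> sat M e' q"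
    using Imp.prems by (auto intro!: Imp.IH[where n = n])
  then show ?case by simp
next
  case (Eq s t)
  then have "eval_tm M e s = eval_tm M e' s" "eval_tm M e t = eval_tm M e' t"
    by (auto intro!: eval_tm_cong[where n = n])
  then show ?case by simp
next
  case (Rel R s t)
  then have "eval_tm M e s = eval_tm M e' s" "eval_tm M e t = eval_tm M e' t"
    by (auto intro!: eval_tm_cong[where n = n])
  then show ?case by simp
qed simp

lemma eval_lift_tm:
  "eval_tm M e (lift_tm k t) = eval_tm M (\<lambda>i. if i < k then e i else e (Suc i)) t"
  by (induction t) auto

lemma sat_lift_fm:
  "sat M e (lift_fm k p) \<longleftrightarrow> sat M (\<lambda>i. if i < k then e i else e (Suc i)) p"
proof (induction p arbitrary: k e)
  case (All p)
  have "(\<lambda>i. if i < Suc k then case_nat x e i else case_nat x e (Suc i)) =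
      case_nat x (\<lambda>i. if i < k then e i else e (Suc i))" for x
    by (auto split: nat.split)
  then show ?case by (simp add: All.IH)
qed (auto simp: eval_lift_tm)

lemma eval_subst_tm:
  "eval_tm M e (subst_tm k u t) =
    eval_tm M (\<lambda>i. if i < k then e i else if i = k then eval_tm M e u else e (i - 1)) t"
  by (induction t) auto

lemma sat_subst_fm:
  "sat M e (subst_fm k u p) \<longleftrightarrow>
    sat M (\<lambda>i. if i < k then e i else if i = k then eval_tm M e u else e (i - 1)) p"
proof (induction p arbitrary: k u e)
  case (All p)
  have "(\<lambda>i. if i < Suc k then case_nat x e i else if i = Suc k
        then eval_tm M (case_nat x e) (lift_tm 0 u) else case_nat x e (i - 1)) =
      case_nat x (\<lambda>i. if i < k then e i else if i = k then eval_tm M e u else e (i - 1))" for x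
    by (auto split: nat.split simp: eval_lift_tm)
  then show ?case by (simp add: All.IH)
qed (auto simp: eval_subst_tm)

lemma sat_subst_fm_0: "sat M e (subst_fm 0 t p) \<longleftrightarrow> sat M (case_nat (eval_tm M e t) e) p"
proof -
  have "(\<lambda>i. if i < 0 then e i else if i = 0 then eval_tm M e t else e (i - 1)) =
      case_nat (eval_tm M e t) e"
    by (auto split: nat.split)
  then show ?thesis by (simp add: sat_subst_fm)
qed

lemma soundness: "proves L G p \<Longrightarrow> (\<forall>q\<in>G. sat M e q) \<Longrightarrow> sat M e p"
proof (induction arbitrary: e rule: proves.induct)
  case (AllI G p)
  have "sat M (case_nat x e) p" for x
    by (rule AllI.IH) (use AllI.prems in \<open>auto simp: sat_lift_fm\<close>)
  then show ?case by simp
next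
  case (Raa p G)
  then show ?case by (metis insert_iff sat.simps(1,4))
qed (auto simp: sat_subst_fm_0)

lemma models_theorem: "models M T \<Longrightarrow> proves L T p \<Longrightarrow> sat M e p"
  by (auto simp: models_def intro: soundness)

lemma models_imp_consistent: "models M T \<Longrightarrow> consistent L T"
  using models_theorem[of M T L Bot] by (auto simp: consistent_def)


section \<open>Existence of models\<close>

lemma proves_mono: "proves L G p \<Longrightarrow> G \<subseteq> H \<Longrightarrow> proves L H p"
proof (induction arbitrary: H rule: proves.induct)
  case (ImpI p G q)
  then show ?case by (meson insert_mono proves.ImpI)
next
  case (Raa p G)
  then show ?case by (meson insert_mono proves.Raa)
next
  case (AllI G p)
  then show ?case by (meson image_mono proves.AllI)
qed (auto intro: proves.intros)

text \<open>Needed at the limit of the Henkin chain. In the case of \<open>AllI\<close> a finite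
  part of the shifted context is the shift of a finite part of the context.\<close>

lemma proves_finite: "proves L G p \<Longrightarrow> \<exists>G0 \<subseteq> G. finite G0 \<and> proves L G0 p"
proof (induction rule: proves.induct)
  case (Assm p G)
  then show ?case by (intro exI[of _ "{p}"]) (auto intro: proves.Assm)
next
  case (ImpI p G q)
  then obtain G0 where "G0 \<subseteq> insert p G" "finite G0" "proves L G0 q" by blast
  then show ?case using ImpI(1)
    by (intro exI[of _ "G0 - {p}"]) (auto intro: proves.ImpI proves_mono)
next
  case (ImpE G p q)
  then obtain G0 G1 where "G0 \<subseteq> G" "finite G0" "proves L G0 (Imp p q)"
    "G1 \<subseteq> G" "finite G1" "proves L G1 p" by blast
  then show ?case
    by (intro exI[of _ "G0 \<union> G1"]) (auto intro: proves.ImpE[of _ _ p] proves_mono)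
next
  case (Raa p G)
  then obtain G0 where "G0 \<subseteq> insert (Neg p) G" "finite G0" "proves L G0 Bot" by blast
  then show ?case using Raa(1)
    by (intro exI[of _ "G0 - {Neg p}"]) (auto intro: proves.Raa proves_mono)
next
  case (AllI G p)
  then obtain G0 where G0: "G0 \<subseteq> lift_fm 0 ` G" "finite G0" "proves L G0 p" by blast
  then obtain G1 where "G1 \<subseteq> G" "finite G1" "G0 = lift_fm 0 ` G1"
    by (meson finite_subset_image)
  then show ?case using G0 by (auto intro: proves.AllI)
next
  case (Leibniz p G s t)
  then obtain G0 G1 where "G0 \<subseteq> G" "finite G0" "proves L G0 (Eq s t)"
    "G1 \<subseteq> G" "finite G1" "proves L G1 (subst_fm 0 s p)" by blast
  then show ?case using Leibniz(1)
    by (intro exI[of _ "G0 \<union> G1"]) (auto intro: proves.Leibniz[of _ _ _ s] proves_mono)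
next
  case (AllE t G p)
  then show ?case by (meson proves.AllE)
next
  case (Refl t G)
  then show ?case by (intro exI[of _ "{}"]) (auto intro: proves.Refl)
qed

section \<open>Renaming of free variables, and generalization on a fresh variable\<close>

text \<open>\<open>k\<close> counts the binders passed, so indices below \<open>k\<close> are bound
  and stay. \<open>g\<close> need not be injective: collapsing all free variables to one is used
  later to obtain a formula in a single variable.\<close>

primrec ren_tm :: "nat \<Rightarrow> (nat \<Rightarrow> nat) \<Rightarrow> tm \<Rightarrow> tm" where
  "ren_tm k g (Var i) = Var (if i < k then i else g (i - k) + k)"
| "ren_tm k g (Const s) = Const s"
| "ren_tm k g (App h t) = App h (ren_tm k g t)"

primrec ren_fm :: "nat \<Rightarrow> (nat \<Rightarrow> nat) \<Rightarrow> fm \<Rightarrow> fm" where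
  "ren_fm k g Bot = Bot"
| "ren_fm k g (Eq s t) = Eq (ren_tm k g s) (ren_tm k g t)"
| "ren_fm k g (Rel R s t) = Rel R (ren_tm k g s) (ren_tm k g t)"
| "ren_fm k g (Imp p q) = Imp (ren_fm k g p) (ren_fm k g q)"
| "ren_fm k g (All p) = All (ren_fm (Suc k) g p)"

lemma tm_in_ren [simp]: "tm_in L (ren_tm k g t) \<longleftrightarrow> tm_in L t"
  by (induction t) auto

lemma fm_in_ren [simp]: "fm_in L (ren_fm k g p) \<longleftrightarrow> fm_in L p"
  by (induction p arbitrary: k) auto

lemma tm_in_lift [simp]: "tm_in L (lift_tm k t) \<longleftrightarrow> tm_in L t"
  by (induction t) auto

lemma fm_in_lift [simp]: "fm_in L (lift_fm k p) \<longleftrightarrow> fm_in L p"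
  by (induction p arbitrary: k) auto

lemma fm_in_subst: "tm_in L t \<Longrightarrow> fm_in L p \<Longrightarrow> fm_in L (subst_fm k t p)"
proof (induction p arbitrary: k t)
  case (Eq u v)
  have "tm_in L w \<Longrightarrow> tm_in L (subst_tm k t w)" for w
    using \<open>tm_in L t\<close> by (induction w) auto
  with Eq show ?case by simp
next
  case (Rel R u v)
  have "tm_in L w \<Longrightarrow> tm_in L (subst_tm k t w)" for w
    using \<open>tm_in L t\<close> by (induction w) auto
  with Rel show ?case by simp
qed auto

lemma ren_tm_lift: "j \<le> k \<Longrightarrow> ren_tm (Suc k) g (lift_tm j t) = lift_tm j (ren_tm k g t)"
  by (induction t) (auto simp: Suc_diff_le)

lemma ren_fm_lift: "j \<le> k \<Longrightarrow> ren_fm (Suc k) g (lift_fm j p) = lift_fm j (ren_fm k g p)"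
  by (induction p arbitrary: j k) (auto simp: ren_tm_lift)

lemma ren_tm_subst:
  "ren_tm k g (subst_tm k t u) = subst_tm k (ren_tm k g t) (ren_tm (Suc k) g u)"
  by (induction u) (auto simp: less_Suc_eq Suc_diff_Suc)

lemma ren_fm_subst:
  "ren_fm k g (subst_fm k t p) = subst_fm k (ren_tm k g t) (ren_fm (Suc k) g p)"
  by (induction p arbitrary: k t) (auto simp: ren_tm_subst ren_tm_lift)

text \<open>Trades one level of depth for a map that fixes index \<open>k\<close>. In
  \<open>proves_ren\<close> the induction hypothesis is available at depth 0 only, while the premise
  of \<open>AllI\<close> needs depth 1.\<close>

lemma ren_tm_Suc: "ren_tm (Suc k) g t = ren_tm k (case_nat 0 (\<lambda>i. Suc (g i))) t"
  by (induction t) (auto split: nat.split simp: less_Suc_eq diff_Suc)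

lemma ren_fm_Suc: "ren_fm (Suc k) g p = ren_fm k (case_nat 0 (\<lambda>i. Suc (g i))) p"
  by (induction p arbitrary: k) (auto simp: ren_tm_Suc)

lemma proves_ren: "proves L G p \<Longrightarrow> proves L (ren_fm 0 g ` G) (ren_fm 0 g p)"
proof (induction arbitrary: g rule: proves.induct)
  case (Assm p G)
  then show ?case by (auto intro: proves.Assm)
next
  case (ImpI p G q)
  have "proves L (ren_fm 0 g ` insert p G) (ren_fm 0 g q)" by (rule ImpI.IH)
  then show ?case using ImpI(1) by (auto intro: proves.ImpI)
next
  case (ImpE G p q)
  have "proves L (ren_fm 0 g ` G) (Imp (ren_fm 0 g p) (ren_fm 0 g q))" 
    using ImpE.IH(1)[of g] by simp
  then show ?case using ImpE.IH(2) by (rule proves.ImpE)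
next
  case (Raa p G)
  have "proves L (ren_fm 0 g ` insert (Neg p) G) (ren_fm 0 g Bot)" by (rule Raa.IH)
  then show ?case using Raa(1) by (auto intro: proves.Raa)
next
  case (AllI G p)
  have "proves L (ren_fm (Suc 0) g ` lift_fm 0 ` G) (ren_fm (Suc 0) g p)"
    unfolding ren_fm_Suc by (rule AllI.IH)
  then show ?case by (auto intro!: proves.AllI simp: image_image ren_fm_lift)
next
  case (AllE t G p)
  have "proves L (ren_fm 0 g ` G) (All (ren_fm (Suc 0) g p))"
    using AllE.IH[of g] by simp
  then show ?case using AllE(1) by (auto intro: proves.AllE simp: ren_fm_subst)
next
  case (Refl t G)
  then show ?case by (auto intro: proves.Refl)
next
  case (Leibniz p G s t)
  have "proves L (ren_fm 0 g ` G) (Eq (ren_tm 0 g s) (ren_tm 0 g t))"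
    "proves L (ren_fm 0 g ` G) (subst_fm 0 (ren_tm 0 g s) (ren_fm (Suc 0) g p))"
    using Leibniz.IH(1)[of g] Leibniz.IH(2)[of g] by (auto simp: ren_fm_subst)
  then show ?case using Leibniz(1)
    by (auto simp: ren_fm_subst intro: proves.Leibniz[of _ _ _ "ren_tm 0 g s"])
qed

text \<open>This renaming moves variable \<open>n\<close> to index 0 and shifts the others up. Where
  all free indices are below \<open>n\<close> it is therefore the shift of \<open>AllI\<close>, and
  it undoes a substitution of \<open>Var n\<close>, as \<open>ren_subst_fresh_fm\<close>
  shows.\<close>

lemma ren_tm_fresh:
  assumes "tm_below (n + k) t"
  shows "ren_tm k (\<lambda>i. if i = n then 0 else Suc i) t = lift_tm k t"
  using assms by (induction t) auto

lemma ren_fm_fresh: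
  assumes "fm_below (n + k) p"
  shows "ren_fm k (\<lambda>i. if i = n then 0 else Suc i) p = lift_fm k p"
  using assms by (induction p arbitrary: k) (auto simp: ren_tm_fresh)

lemma ren_subst_fresh_tm:
  assumes "tm_below (Suc n + k) t"
  shows "ren_tm k (\<lambda>i. if i = n then 0 else Suc i) (subst_tm k (Var (n + k)) t) = t"
  using assms by (induction t) auto

lemma ren_subst_fresh_fm:
  assumes "fm_below (Suc n + k) p"
  shows "ren_fm k (\<lambda>i. if i = n then 0 else Suc i) (subst_fm k (Var (n + k)) p) = p"
  using assms
proof (induction p arbitrary: k)
  case (All p)
  then show ?case using All.IH[of "Suc k"] by simp
qed (use ren_subst_fresh_tm[of n] in auto)

text \<open>The eigenvariable form of \<open>AllI\<close>, which the Henkin argument needs: renaming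
  \<open>n\<close> to 0 turns the unshifted context into the shifted one.\<close>

lemma AllI_fresh:
  assumes "proves L G (subst_fm 0 (Var n) p)" "fm_below n (All p)" "\<And>q. q \<in> G \<Longrightarrow> fm_below n q"
  shows "proves L G (All p)"
proof -
  let ?g = "\<lambda>i. if i = n then 0 else Suc i"
  have "proves L (ren_fm 0 ?g ` G) (ren_fm 0 ?g (subst_fm 0 (Var n) p))"
    using assms(1) by (rule proves_ren)
  moreover have "ren_fm 0 ?g ` G = lift_fm 0 ` G"
    using assms(3) ren_fm_fresh[of n 0] by (intro image_cong) auto
  moreover have "ren_fm 0 ?g (subst_fm 0 (Var n) p) = p"
    using ren_subst_fresh_fm[of n 0 p] assms(2) by simp
  ultimately show ?thesis by (auto intro: proves.AllI)
qed

lemma tm_below_mono: "tm_below m t \<Longrightarrow> m \<le> n \<Longrightarrow> tm_below n t"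
  by (induction t) auto

lemma fm_below_mono: "fm_below m p \<Longrightarrow> m \<le> n \<Longrightarrow> fm_below n p"
proof (induction p arbitrary: m n)
  case (All p)
  then show ?case using All.IH[of "Suc m" "Suc n"] by simp
qed (auto dest: tm_below_mono)

lemma ex_fm_below: "\<exists>n. fm_below n p"
proof -
  have t: "\<exists>n. tm_below n t" for t by (induction t) auto
  show ?thesis
  proof (induction p)
    case (Eq s t)
    obtain m n where "tm_below m s" "tm_below n t" using t by blast
    then have "tm_below (max m n) s" "tm_below (max m n) t" by (auto elim: tm_below_mono)
    then show ?case by auto
  next
    case (Rel R s t)
    obtain m n where "tm_below m s" "tm_below n t" using t by blast
    then have "tm_below (max m n) s" "tm_below (max m n) t" by (auto elim: tm_below_mono)
    then show ?case by auto
  next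
    case (Imp p q)
    then obtain m n where "fm_below m p" "fm_below n q" by blast
    then have "fm_below (max m n) p" "fm_below (max m n) q" by (auto elim: fm_below_mono)
    then show ?case by auto
  next
    case (All p)
    then show ?case by (auto intro: fm_below_mono[OF _ le_SucI[OF order_refl]])
  qed auto
qed

section \<open>Henkin completion of a consistent set of sentences\<close>

lemma proves_NegI:
  "fm_in L p \<Longrightarrow> \<not> consistent L (insert p G) \<Longrightarrow> proves L G (Neg p)"
  by (auto simp: consistent_def intro: proves.ImpI)

lemma proves_Raa:
  "fm_in L p \<Longrightarrow> \<not> consistent L (insert (Neg p) G) \<Longrightarrow> proves L G p"
  by (auto simp: consistent_def intro: proves.Raa)

text \<open>Free variables never occur in sentences, so they can serve as Henkin constants.\<close>

definition witness :: "fm set \<Rightarrow> fm \<Rightarrow> fm set" where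
  "witness G p = (case p of
      Imp (All q) Bot \<Rightarrow> {Neg (subst_fm 0 (Var (SOME n. \<forall>r \<in> insert p G. fm_below n r)) q)}
    | _ \<Rightarrow> {})"

text \<open>Formula and witness enter in one step. Each stage has only finitely many formulas beyond
  the sentences of \<open>T\<close>, so its free variables are bounded and a fresh one
  exists.\<close>

definition add_fm :: "lang \<Rightarrow> fm \<Rightarrow> fm set \<Rightarrow> fm set" where
  "add_fm L p G = (if fm_in L p \<and> consistent L (insert p G) then witness G p \<union> insert p G else G)"

text \<open>Stage \<open>Suc n\<close> treats the formula with code \<open>n\<close>. If
  \<open>n\<close> is not a code, \<open>inv fm_code n\<close> is some unknown formula; it does no
  harm, since \<open>add_fm\<close> tests whatever it is given.\<close>

primrec henkin_chain :: "lang \<Rightarrow> fm set \<Rightarrow> nat \<Rightarrow> fm set" where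
  "henkin_chain L T 0 = T"
| "henkin_chain L T (Suc n) = add_fm L (inv fm_code n) (henkin_chain L T n)"

definition henkin :: "lang \<Rightarrow> fm set \<Rightarrow> fm set" where
  "henkin L T = (\<Union>n. henkin_chain L T n)"

lemma witness_Neg_All:
  assumes "\<exists>n. \<forall>q\<in>G. fm_below n q"
  shows "\<exists>n. witness G (Neg (All q)) = {Neg (subst_fm 0 (Var n) q)} \<and>
    (\<forall>r \<in> insert (Neg (All q)) G. fm_below n r)"
proof -
  obtain m where m: "\<forall>q\<in>G. fm_below m q" using assms by blast
  obtain k where k: "fm_below k (Neg (All q))" using ex_fm_below by blast
  have "\<forall>r \<in> insert (Neg (All q)) G. fm_below (max m k) r"
    using m k fm_below_mono by (metis insertE max.cobounded1 max.cobounded2)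
  then have "\<forall>r \<in> insert (Neg (All q)) G.
      fm_below (SOME n. \<forall>r \<in> insert (Neg (All q)) G. fm_below n r) r"
    by (rule someI)
  then show ?thesis by (auto simp: witness_def)
qed

lemma witness_cases:
  obtains "witness G p = {}" | q where "p = Neg (All q)"
  by (cases "\<exists>q. p = Neg (All q)") (auto simp: witness_def split: fm.splits)

text \<open>If the witness made the set inconsistent, the instance at the fresh variable would be
  derivable, hence the universal formula by \<open>AllI_fresh\<close>, against its negation
  \<open>p\<close>.\<close>

lemma consistent_witness:
  assumes "consistent L (insert p G)" "fm_in L p" "\<exists>n. \<forall>q\<in>G. fm_below n q"
  shows "consistent L (witness G p \<union> insert p G)"
proof (cases rule: witness_cases[of G p])
  case 1
  then show ?thesis using assms by simp
next
  case (2 q)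
  obtain n where w: "witness G p = {Neg (subst_fm 0 (Var n) q)}"
    and n: "\<forall>r \<in> insert p G. fm_below n r"
    using witness_Neg_All[OF assms(3), of q] 2 by blast
  show ?thesis
  proof (rule ccontr)
    assume "\<not> ?thesis"
    then have "proves L (insert p G) (subst_fm 0 (Var n) q)"
      unfolding w using assms(2) 2
      by (intro proves_Raa) (auto simp: fm_in_subst insert_commute)
    then have "proves L (insert p G) (All q)"
      by (rule AllI_fresh) (use n 2 in auto)
    moreover have "proves L (insert p G) (Neg (All q))"
      using assms(2) 2 by (auto intro: proves.Assm)
    ultimately have "proves L (insert p G) Bot" by (rule proves.ImpE[rotated])
    then show False using assms(1) by (simp add: consistent_def)
  qed
qed

lemma finite_witness: "finite (witness G p)"
  by (cases rule: witness_cases[of G p]) (auto simp: witness_def)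

lemma fm_in_witness: "fm_in L p \<Longrightarrow> q \<in> witness G p \<Longrightarrow> fm_in L q"
  by (auto simp: witness_def fm_in_subst split: fm.splits)

lemma bound_union_finite:
  assumes "\<exists>n. \<forall>q\<in>G. fm_below n q" "finite H"
  shows "\<exists>n. \<forall>q\<in>H \<union> G. fm_below n q"
  using assms(2)
proof (induction H rule: finite_induct)
  case (insert p H)
  then obtain m where m: "\<forall>q\<in>H \<union> G. fm_below m q" by blast
  obtain k where k: "fm_below k p" using ex_fm_below by blast
  have "\<forall>q\<in>insert p H \<union> G. fm_below (max m k) q"
    using m k fm_below_mono by (metis Un_iff insertE max.cobounded1 max.cobounded2)
  then show ?case by blast
qed (use assms in simp)

context
  fixes L :: lang and T :: "fm set"
  assumes T: "T \<subseteq> sentences L" "consistent L T"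
begin

lemma henkin_chain_bound: "\<exists>m. \<forall>q\<in>henkin_chain L T n. fm_below m q"
proof (induction n)
  case 0
  then show ?case using T by (auto simp: sentences_def)
next
  case (Suc n)
  have "\<exists>m. \<forall>q\<in>insert (inv fm_code n) (witness (henkin_chain L T n) (inv fm_code n))
      \<union> henkin_chain L T n. fm_below m q"
    using Suc finite_witness by (intro bound_union_finite) auto
  then show ?case using Suc by (auto simp: add_fm_def)
qed

lemma henkin_chain_consistent: "consistent L (henkin_chain L T n)"
  using T henkin_chain_bound consistent_witness by (induction n) (auto simp: add_fm_def)

lemma henkin_chain_mono: "m \<le> n \<Longrightarrow> henkin_chain L T m \<subseteq> henkin_chain L T n"
  by (rule lift_Suc_mono_le[of "henkin_chain L T"]) (auto simp: add_fm_def)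

lemma henkin_in: "p \<in> henkin L T \<Longrightarrow> fm_in L p"
proof -
  have "p \<in> henkin_chain L T n \<Longrightarrow> fm_in L p" for n
    using T by (induction n) (auto simp: add_fm_def sentences_def fm_in_witness split: if_splits)
  then show "p \<in> henkin L T \<Longrightarrow> fm_in L p" by (auto simp: henkin_def)
qed

lemma henkin_consistent: "consistent L (henkin L T)"
proof (rule ccontr)
  assume "\<not> consistent L (henkin L T)"
  then obtain G0 where G0: "G0 \<subseteq> henkin L T" "finite G0" "proves L G0 Bot"
    using proves_finite[of L "henkin L T" Bot] by (auto simp: consistent_def)
  have "\<exists>n. G0 \<subseteq> henkin_chain L T n"
    using G0(2,1)
  proof (induction G0 rule: finite_induct)
    case (insert p H)
    then obtain m n where "H \<subseteq> henkin_chain L T n" "p \<in> henkin_chain L T m"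
      by (auto simp: henkin_def)
    then have "insert p H \<subseteq> henkin_chain L T (max m n)"
      using henkin_chain_mono[of m "max m n"] henkin_chain_mono[of n "max m n"] by auto
    then show ?case by blast
  qed simp
  then obtain n where "proves L (henkin_chain L T n) Bot" using G0(3) proves_mono by blast
  then show False using henkin_chain_consistent by (simp add: consistent_def)
qed

text \<open>Consistency with the union implies consistency with the stage at which \<open>p\<close>
  is treated, so \<open>p\<close> is taken there. The second claim keeps the boundedness of that
  stage, from which \<open>witness_Neg_All\<close> recovers the shape of the witness.\<close>

lemma henkin_add:
  assumes "fm_in L p" "consistent L (insert p (henkin L T))"
  shows "p \<in> henkin L T" and "\<exists>G. (\<exists>n. \<forall>q\<in>G. fm_below n q) \<and> witness G p \<subseteq> henkin L T"
proof -
  have inv: "inv fm_code (fm_code p) = p"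
    using fm_code_inj by (intro inv_f_f injI) auto
  let ?G = "henkin_chain L T (fm_code p)"
  have "consistent L (insert p ?G)"
    using assms(2) proves_mono[of L "insert p ?G" Bot "insert p (henkin L T)"]
    by (auto simp: consistent_def henkin_def)
  then have "witness ?G p \<union> insert p ?G = henkin_chain L T (Suc (fm_code p))"
    using assms(1) by (simp add: add_fm_def inv)
  then have "witness ?G p \<union> insert p ?G \<subseteq> henkin L T"
    unfolding henkin_def by blast
  then show "p \<in> henkin L T" "\<exists>G. (\<exists>n. \<forall>q\<in>G. fm_below n q) \<and> witness G p \<subseteq> henkin L T"
    using henkin_chain_bound by blast+
qed

lemma henkin_proves: "p \<in> henkin L T \<Longrightarrow> proves L (henkin L T) p"
  by (simp add: henkin_in proves.Assm)

lemma henkin_proves_iff: "fm_in L p \<Longrightarrow> proves L (henkin L T) p \<longleftrightarrow> p \<in> henkin L T"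
proof
  assume p: "fm_in L p" "proves L (henkin L T) p"
  have "consistent L (insert p (henkin L T))"
  proof (rule ccontr)
    assume "\<not> ?thesis"
    then have "proves L (henkin L T) (Neg p)" using p by (intro proves_NegI)
    then have "proves L (henkin L T) Bot" using p(2) by (rule proves.ImpE)
    then show False using henkin_consistent by (simp add: consistent_def)
  qed
  then show "p \<in> henkin L T" by (rule henkin_add(1)[OF p(1)])
qed (simp add: proves.Assm)

lemma henkin_Bot: "Bot \<notin> henkin L T"
  using henkin_proves_iff[of Bot] henkin_consistent by (auto simp: consistent_def)

lemma henkin_Neg: "fm_in L p \<Longrightarrow> Neg p \<in> henkin L T \<longleftrightarrow> p \<notin> henkin L T"
proof
  assume p: "fm_in L p" "Neg p \<in> henkin L T"
  show "p \<notin> henkin L T"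
  proof
    assume "p \<in> henkin L T"
    then have "proves L (henkin L T) Bot"
      using p proves.ImpE henkin_proves by blast
    then show False using henkin_consistent by (simp add: consistent_def)
  qed
next
  assume p: "fm_in L p" "p \<notin> henkin L T"
  then have "\<not> consistent L (insert p (henkin L T))" using henkin_add(1) by blast
  then have "proves L (henkin L T) (Neg p)" using p by (intro proves_NegI)
  then show "Neg p \<in> henkin L T" using p henkin_proves_iff[of "Neg p"] by simp
qed

lemma henkin_Imp:
  assumes "fm_in L p" "fm_in L q"
  shows "Imp p q \<in> henkin L T \<longleftrightarrow> (p \<in> henkin L T \<longrightarrow> q \<in> henkin L T)"
proof
  assume "Imp p q \<in> henkin L T"
  then show "p \<in> henkin L T \<longrightarrow> q \<in> henkin L T"
    using assms henkin_proves_iff[of q] proves.ImpE henkin_proves by blast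
next
  assume "p \<in> henkin L T \<longrightarrow> q \<in> henkin L T"
  then have "Neg p \<in> henkin L T \<or> q \<in> henkin L T" using henkin_Neg assms by blast
  then have "proves L (insert p (henkin L T)) q"
  proof
    assume "Neg p \<in> henkin L T"
    then have "proves L (insert (Neg q) (insert p (henkin L T))) Bot"
      using assms by (intro proves.ImpE[of L _ p Bot]) (auto intro: proves.Assm)
    then show ?thesis using assms by (auto intro: proves.Raa)
  qed (use assms in \<open>auto intro: proves.Assm\<close>)
  then show "Imp p q \<in> henkin L T"
    using assms henkin_proves_iff[of "Imp p q"] by (auto intro: proves.ImpI)
qed

lemma henkin_All:
  assumes "fm_in L p"
  shows "All p \<in> henkin L T \<longleftrightarrow> (\<forall>t. tm_in L t \<longrightarrow> subst_fm 0 t p \<in> henkin L T)"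
proof
  assume "All p \<in> henkin L T"
  then show "\<forall>t. tm_in L t \<longrightarrow> subst_fm 0 t p \<in> henkin L T"
    using assms henkin_proves_iff[OF fm_in_subst] proves.AllE henkin_proves by blast
next
  assume *: "\<forall>t. tm_in L t \<longrightarrow> subst_fm 0 t p \<in> henkin L T"
  show "All p \<in> henkin L T"
  proof (rule ccontr)
    assume "All p \<notin> henkin L T"
    then have "Neg (All p) \<in> henkin L T" using henkin_Neg assms by simp
    \<comment> \<open>The formula is already a member, so inserting it changes nothing; the point is
      to apply \<open>henkin_add\<close>, which supplies its witness.\<close>
    then have "consistent L (insert (Neg (All p)) (henkin L T))"
      using henkin_consistent by (simp add: insert_absorb)
    then obtain G where "\<exists>n. \<forall>q\<in>G. fm_below n q" "witness G (Neg (All p)) \<subseteq> henkin L T"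
      using henkin_add(2) assms by (metis fm_in.simps(1,4,5))
    then obtain n where "Neg (subst_fm 0 (Var n) p) \<in> henkin L T"
      using witness_Neg_All[of G p] by auto
    then show False using * henkin_Neg[of "subst_fm 0 (Var n) p"] assms by (auto simp: fm_in_subst)
  qed
qed

lemma subst_lift_tm: "subst_tm k u (lift_tm k t) = t"
  by (induction t) auto

lemma henkin_Leibniz:
  assumes "Eq s t \<in> henkin L T" "fm_in L p" "subst_fm 0 s p \<in> henkin L T"
  shows "subst_fm 0 t p \<in> henkin L T"
proof -
  have "tm_in L s" "tm_in L t" using henkin_in[OF assms(1)] by auto
  then show ?thesis
    using assms henkin_proves_iff[of "subst_fm 0 t p"] fm_in_subst[of L t p 0]
      proves.Leibniz[of L p "henkin L T" s t] henkin_proves by simp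
qed

lemma henkin_Eq_refl: "tm_in L t \<Longrightarrow> Eq t t \<in> henkin L T"
  using henkin_proves_iff[of "Eq t t"] by (auto intro: proves.Refl)

lemma henkin_Eq_sym: "Eq s t \<in> henkin L T \<Longrightarrow> Eq t s \<in> henkin L T"
  using henkin_Leibniz[of s t "Eq (Var 0) (lift_tm 0 s)"] henkin_in[of "Eq s t"]
  by (auto simp: subst_lift_tm henkin_Eq_refl)

lemma henkin_Eq_trans: "Eq s t \<in> henkin L T \<Longrightarrow> Eq t u \<in> henkin L T \<Longrightarrow> Eq s u \<in> henkin L T"
  using henkin_Leibniz[of t u "Eq (lift_tm 0 s) (Var 0)"] henkin_in[of "Eq s t"]
  by (auto simp: subst_lift_tm)

lemma henkin_Eq_App:
  "Eq s t \<in> henkin L T \<Longrightarrow> g \<in> funs_of L \<Longrightarrow> Eq (App g s) (App g t) \<in> henkin L T"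
  using henkin_Leibniz[of s t "Eq (lift_tm 0 (App g s)) (App g (Var 0))"] henkin_in[of "Eq s t"]
  by (auto simp: subst_lift_tm henkin_Eq_refl)

lemma henkin_Rel:
  assumes "Eq s s' \<in> henkin L T" "Eq t t' \<in> henkin L T" "Rel R s t \<in> henkin L T"
  shows "Rel R s' t' \<in> henkin L T"
proof -
  have "Rel R s' t \<in> henkin L T"
    using assms henkin_Leibniz[of s s' "Rel R (Var 0) (lift_tm 0 t)"] henkin_in[of "Rel R s t"]
    by (auto simp: subst_lift_tm)
  then show ?thesis
    using assms henkin_Leibniz[of t t' "Rel R (lift_tm 0 s') (Var 0)"] henkin_in[of "Rel R s' t"]
    by (auto simp: subst_lift_tm)
qed

text \<open>Infinitely many provably distinct terms make the term model countably infinite, so its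
  elements can be renamed to be exactly the natural numbers.\<close>

lemma term_quotient:
  assumes u: "\<And>i. tm_in L (u i)" "\<And>i j :: nat. i \<noteq> j \<Longrightarrow> proves L T (Neg (Eq (u i) (u j)))"
  obtains q :: "tm \<Rightarrow> nat" where
    "\<And>s t. tm_in L s \<Longrightarrow> tm_in L t \<Longrightarrow> q s = q t \<longleftrightarrow> Eq s t \<in> henkin L T"
    "\<And>x. \<exists>t. tm_in L t \<and> q t = x"
proof -
  define cl where "cl t = {s. Eq t s \<in> henkin L T}" for t
  have cl: "cl s = cl t \<longleftrightarrow> Eq s t \<in> henkin L T" if "tm_in L s" "tm_in L t" for s t
    using that unfolding cl_def by (auto intro: henkin_Eq_refl henkin_Eq_sym henkin_Eq_trans)
  let ?K = "cl ` {t. tm_in L t}"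
  have "inj tm_code" using tm_code_inj by (auto intro: injI)
  then have "countable (UNIV :: tm set)" by (rule countableI)
  then have "countable ?K" using countable_subset[OF subset_UNIV] by (intro countable_image) blast
  moreover have "infinite ?K"
  proof -
    have "Neg (Eq (u i) (u j)) \<in> henkin L T" if "i \<noteq> j" for i j
    proof -
      have "T \<subseteq> henkin L T" unfolding henkin_def using henkin_chain.simps(1) by blast
      then have "proves L (henkin L T) (Neg (Eq (u i) (u j)))"
        using u(2)[OF that] proves_mono by blast
      then show ?thesis using henkin_proves_iff[of "Neg (Eq (u i) (u j))"] u by simp
    qed
    then have "inj (\<lambda>i. cl (u i))"
      using cl u henkin_Neg by (intro injI) (metis fm_in.simps(2))
    then have "infinite (range (\<lambda>i. cl (u i)))" by (simp add: finite_image_iff)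
    moreover have "range (\<lambda>i. cl (u i)) \<subseteq> ?K" using u by auto
    ultimately show ?thesis using finite_subset by blast
  qed
  ultimately have b: "bij_betw (to_nat_on ?K) ?K UNIV" by (rule to_nat_on_infinite)
  show thesis
  proof
    show "to_nat_on ?K (cl s) = to_nat_on ?K (cl t) \<longleftrightarrow> Eq s t \<in> henkin L T"
      if "tm_in L s" "tm_in L t" for s t
    proof -
      have "inj_on (to_nat_on ?K) ?K" using b by (simp add: bij_betw_def)
      then show ?thesis using that cl by (simp add: inj_on_eq_iff)
    qed
    show "\<exists>t. tm_in L t \<and> to_nat_on ?K (cl t) = x" for x
    proof -
      have "x \<in> to_nat_on ?K ` ?K" using b by (simp add: bij_betw_def)
      then show ?thesis by blast
    qed
  qed
qed

text \<open>The truth lemma goes by induction on size: an instance of the body of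
  \<open>All p\<close> is not a subformula, but it is as small as the body.\<close>

lemma size_subst_fm: "size (subst_fm k t p) = size p"
  by (induction p arbitrary: k t) auto

text \<open>The term model. Functions and relations are evaluated at representatives
  \<open>r\<close> of the classes, and the congruence lemmas make the choice irrelevant. Variables
  count as constants here, so \<open>e\<close> sends each to its own class; under this assignment
  satisfaction is membership in the Henkin set.\<close>

theorem model_existence:
  assumes u: "\<And>i. tm_in L (u i)" "\<And>i j :: nat. i \<noteq> j \<Longrightarrow> proves L T (Neg (Eq (u i) (u j)))"
  shows "\<exists>M :: nat struct. models M T"
proof -
  obtain q :: "tm \<Rightarrow> nat" where
    q: "\<And>s t. tm_in L s \<Longrightarrow> tm_in L t \<Longrightarrow> q s = q t \<longleftrightarrow> Eq s t \<in> henkin L T"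
    and surj: "\<And>x. \<exists>t. tm_in L t \<and> q t = x"
    using term_quotient[of u, OF u] by metis
  obtain r where r: "\<And>x. tm_in L (r x)" "\<And>x. q (r x) = x" using surj by metis
  have rq: "Eq (r (q t)) t \<in> henkin L T" if "tm_in L t" for t
    using q[of "r (q t)" t] r that by simp
  define M where "M = \<lparr>const_of = (\<lambda>s. q (Const s)), fun_of = (\<lambda>g x. q (App g (r x))),
    rel_of = (\<lambda>R x y. Rel R (r x) (r y) \<in> henkin L T)\<rparr>"
  define e where "e i = q (Var i)" for i
  have ev: "tm_in L t \<Longrightarrow> eval_tm M e t = q t" for t
  proof (induction t)
    case (App g t)
    then show ?case using henkin_Eq_App[OF rq] r q by (auto simp: M_def)
  qed (auto simp: M_def e_def)
  have truth: "fm_in L p \<Longrightarrow> sat M e p \<longleftrightarrow> p \<in> henkin L T" for p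
  proof (induction "size p" arbitrary: p rule: less_induct)
    case less
    show ?case
    proof (cases p)
      case Bot
      then show ?thesis using henkin_Bot by simp
    next
      case (Eq s t)
      then show ?thesis using less.prems q ev by simp
    next
      case (Rel R s t)
      then have "tm_in L s" "tm_in L t" using less.prems by auto
      then have "Rel R (r (q s)) (r (q t)) \<in> henkin L T \<longleftrightarrow> Rel R s t \<in> henkin L T"
        using henkin_Rel rq henkin_Eq_sym by meson
      then show ?thesis using Rel less.prems ev by (simp add: M_def)
    next
      case (Imp p1 p2)
      then show ?thesis using less henkin_Imp by simp
    next
      case (All p1)
      have "sat M (case_nat (q t) e) p1 \<longleftrightarrow> subst_fm 0 t p1 \<in> henkin L T" if "tm_in L t" for t
      proof -
        have "sat M e (subst_fm 0 t p1) \<longleftrightarrow> subst_fm 0 t p1 \<in> henkin L T"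
          using less All that by (intro less.hyps) (auto simp: size_subst_fm fm_in_subst)
        then show ?thesis using ev[OF that] by (simp add: sat_subst_fm_0)
      qed
      then have "sat M e (All p1) \<longleftrightarrow> (\<forall>t. tm_in L t \<longrightarrow> subst_fm 0 t p1 \<in> henkin L T)"
        using surj by (metis sat.simps(5))
      then show ?thesis using henkin_All All less.prems by simp
    qed
  qed
  have "sat M e' p" if "p \<in> T" for p e'
  proof -
    have "T \<subseteq> henkin L T" unfolding henkin_def using henkin_chain.simps(1) by blast
    then have "sat M e p" using truth that henkin_in by blast
    \<comment> \<open>So far truth is known under \<open>e\<close> only; a sentence does not depend
      on the assignment.\<close>
    moreover have "fm_below 0 p" using T that by (auto simp: sentences_def)
    ultimately show ?thesis using sat_cong[of 0 p e e' M] by simp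
  qed
  then show ?thesis by (auto simp: models_def)
qed

end


section \<open>Some recursive functions\<close>

text \<open>The values of a \<open>recursive\<close> function on lists of the wrong length are fixed
  by the schemes that built it. Comparing on lists of length \<open>n\<close> only makes rewriting
  possible.\<close>

definition computable :: "nat \<Rightarrow> (nat list \<Rightarrow> nat) \<Rightarrow> bool" where
  "computable n f \<longleftrightarrow> (\<exists>g. recursive n g \<and> (\<forall>xs. length xs = n \<longrightarrow> g xs = f xs))"

lemma computable_cong:
  "computable n f \<Longrightarrow> (\<And>xs. length xs = n \<Longrightarrow> f xs = g xs) \<Longrightarrow> computable n g"
  by (auto simp: computable_def)

lemma computable_proj: "i < n \<Longrightarrow> computable n (\<lambda>xs. xs ! i)"
  by (auto simp: computable_def intro: recursive.proj)

lemma computable_comp1: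
  assumes "computable 1 (\<lambda>xs. f (xs ! 0))" "computable n g"
  shows "computable n (\<lambda>xs. f (g xs))"
proof -
  obtain f' g' where "recursive 1 f'" "\<And>xs. length xs = 1 \<Longrightarrow> f' xs = f (xs ! 0)"
    "recursive n g'" "\<And>xs. length xs = n \<Longrightarrow> g' xs = g xs"
    using assms by (auto simp: computable_def)
  then show ?thesis
    using recursive.comp[of "[g']" f' n] by (auto simp: computable_def)
qed

lemma computable_comp2:
  assumes "computable 2 (\<lambda>xs. f (xs ! 0) (xs ! 1))" "computable n g" "computable n h"
  shows "computable n (\<lambda>xs. f (g xs) (h xs))"
proof -
  obtain f' g' h' where fgh: "recursive 2 f'" "\<And>xs. length xs = 2 \<Longrightarrow> f' xs = f (xs ! 0) (xs ! 1)"
    "recursive n g'" "\<And>xs. length xs = n \<Longrightarrow> g' xs = g xs"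
    "recursive n h'" "\<And>xs. length xs = n \<Longrightarrow> h' xs = h xs"
    using assms by (auto simp: computable_def)
  have "recursive n (\<lambda>xs. f' (map (\<lambda>k. k xs) [g', h']))"
    using fgh by (intro recursive.comp) (auto simp: numeral_2_eq_2)
  then show ?thesis
    using fgh by (auto simp: computable_def intro!: exI[of _ "\<lambda>xs. f' [g' xs, h' xs]"])
qed

lemma computable_Suc: "computable n f \<Longrightarrow> computable n (\<lambda>xs. Suc (f xs))"
proof (rule computable_comp1[where f = Suc])
  show "computable 1 (\<lambda>xs. Suc (xs ! 0))"
    using recursive.succ by (auto simp: computable_def)
qed

lemma computable_const: "computable n (\<lambda>xs. k)"
proof (induction k)
  case 0
  then show ?case using recursive.zero by (auto simp: computable_def)
next
  case (Suc k)
  then show ?case by (rule computable_Suc)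
qed

lemma computable_rec_nat:
  assumes "computable n f" "computable (Suc (Suc n)) g"
  shows "computable (Suc n) (\<lambda>xs. rec_nat (f (tl xs)) (\<lambda>k r. g (k # r # tl xs)) (xs ! 0))"
proof -
  obtain f' g' where fg: "recursive n f'" "\<And>xs. length xs = n \<Longrightarrow> f' xs = f xs"
    "recursive (Suc (Suc n)) g'" "\<And>xs. length xs = Suc (Suc n) \<Longrightarrow> g' xs = g xs"
    using assms by (auto simp: computable_def)
  have "rec_nat (f' (tl xs)) (\<lambda>k r. g' (k # r # tl xs)) (hd xs) =
      rec_nat (f (tl xs)) (\<lambda>k r. g (k # r # tl xs)) (xs ! 0)" if "length xs = Suc n" for xs
    using that fg by (cases xs) auto
  then show ?thesis
    using recursive.prec[OF fg(1,3)] by (auto simp: computable_def)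
qed

lemma computable_iterate:
  assumes "computable 1 (\<lambda>xs. g (xs ! 0))"
  shows "computable 1 (\<lambda>xs. rec_nat a (\<lambda>_ r. g r) (xs ! 0))"
proof -
  have "computable (Suc (Suc 0)) (\<lambda>xs. g (xs ! 1))"
    by (rule computable_comp1[OF assms computable_proj]) simp
  from computable_rec_nat[OF computable_const[of 0 a] this] show ?thesis
    by (auto elim!: computable_cong)
qed

lemma computable_add:
  assumes "computable n f" "computable n g"
  shows "computable n (\<lambda>xs. f xs + g xs)"
proof (rule computable_comp2[where f = "(+)", OF _ assms])
  have "computable (Suc 0) (\<lambda>xs. xs ! 0)" "computable (Suc (Suc (Suc 0))) (\<lambda>xs. Suc (xs ! 1))"
    by (intro computable_Suc computable_proj; simp)+
  note computable_rec_nat[OF this]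
  then show "computable 2 (\<lambda>xs. xs ! 0 + xs ! 1)"
    unfolding numeral_2_eq_2
  proof (rule computable_cong)
    fix xs :: "nat list"
    assume "length xs = Suc (Suc 0)"
    then obtain x y where "xs = [x, y]" by (auto simp: length_Suc_conv)
    moreover have "rec_nat y (\<lambda>k r. Suc r) x = x + y" by (induction x) auto
    ultimately show "rec_nat (tl xs ! 0) (\<lambda>k r. Suc ((k # r # tl xs) ! 1)) (xs ! 0) = xs ! 0 + xs ! 1"
      by simp
  qed
qed

text \<open>\<open>prod_encode\<close> adds its first argument to the triangular number of the sum,
  and triangular numbers arise by primitive recursion.\<close>

lemma computable_prod_encode:
  assumes "computable n f" "computable n g"
  shows "computable n (\<lambda>xs. prod_encode (f xs, g xs))"
proof -
  have "computable (Suc (Suc 0)) (\<lambda>xs. xs ! 1 + Suc (xs ! 0))"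
    by (intro computable_add computable_Suc computable_proj) auto
  note computable_rec_nat[OF computable_const[of 0 0] this]
  then have "computable (Suc 0) (\<lambda>xs. triangle (xs ! 0))"
  proof (rule computable_cong)
    fix xs :: "nat list"
    have "rec_nat 0 (\<lambda>k r. r + Suc k) n = triangle n" for n by (induction n) auto
    then show "rec_nat 0 (\<lambda>k r. (k # r # tl xs) ! 1 + Suc ((k # r # tl xs) ! 0)) (xs ! 0)
      = triangle (xs ! 0)" by simp
  qed
  then have "computable 1 (\<lambda>xs. triangle (xs ! 0))" by simp
  from computable_add[OF computable_comp1[OF this computable_add[OF assms]] assms(1)]
  show ?thesis by (simp add: prod_encode_def)
qed


section \<open>Definable predicates\<close>

text \<open>Stated for predicates of a structure and an assignment, so that formulas with de Bruijn
  indices need not be written out. One formula has to serve all structures.\<close>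

definition definable :: "lang \<Rightarrow> (nat struct \<Rightarrow> (nat \<Rightarrow> nat) \<Rightarrow> bool) \<Rightarrow> bool" where
  "definable L X \<longleftrightarrow> (\<exists>p. fm_in L p \<and> (\<forall>M e. sat M e p \<longleftrightarrow> X M e))"

lemma definable_fm: "fm_in L p \<Longrightarrow> definable L (\<lambda>M e. sat M e p)"
  by (auto simp: definable_def)

lemma definable_imp:
  assumes "definable L X" "definable L Y"
  shows "definable L (\<lambda>M e. X M e \<longrightarrow> Y M e)"
proof -
  obtain p q where "fm_in L p" "\<And>M e. sat M e p \<longleftrightarrow> X M e" "fm_in L q" "\<And>M e. sat M e q \<longleftrightarrow> Y M e"
    using assms by (auto simp: definable_def)
  then show ?thesis using definable_fm[of L "Imp p q"] by simp
qed

lemma definable_not: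
  assumes "definable L X"
  shows "definable L (\<lambda>M e. \<not> X M e)"
proof -
  have "definable L (\<lambda>M e. False)" using definable_fm[of L Bot] by simp
  from definable_imp[OF assms this] show ?thesis by simp
qed

lemma definable_disj:
  assumes "definable L X" "definable L Y"
  shows "definable L (\<lambda>M e. X M e \<or> Y M e)"
  using definable_imp[OF definable_not[OF assms(1)] assms(2)] by (simp add: disj_imp)

lemma definable_conj:
  assumes "definable L X" "definable L Y"
  shows "definable L (\<lambda>M e. X M e \<and> Y M e)"
  using definable_not[OF definable_imp[OF assms(1) definable_not[OF assms(2)]]] by simp

lemma definable_iff:
  assumes "definable L X" "definable L Y"
  shows "definable L (\<lambda>M e. X M e \<longleftrightarrow> Y M e)"
  using definable_conj[OF definable_imp[OF assms] definable_imp[OF assms(2,1)]]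
  by (simp add: iff_conv_conj_imp)

lemma definable_all:
  assumes "definable L (\<lambda>M e. X M (e 0) (\<lambda>i. e (Suc i)))"
  shows "definable L (\<lambda>M e. \<forall>x. X M x e)"
proof -
  obtain p where "fm_in L p" "\<And>M e. sat M e p \<longleftrightarrow> X M (e 0) (\<lambda>i. e (Suc i))"
    using assms by (auto simp: definable_def)
  then show ?thesis using definable_fm[of L "All p"] by simp
qed

lemma definable_ex:
  assumes "definable L (\<lambda>M e. X M (e 0) (\<lambda>i. e (Suc i)))"
  shows "definable L (\<lambda>M e. \<exists>x. X M x e)"
  using definable_not[OF definable_all[where X = "\<lambda>M x e. \<not> X M x e", OF definable_not[OF assms]]]
  by simp

lemmas definable_intros =
  definable_imp definable_not definable_disj definable_conj definable_iff definable_all definable_ex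

section \<open>Change of variables and blocks of quantifiers in definable predicates\<close>

lemma eval_ren_tm:
  "eval_tm M e (ren_tm k g t) = eval_tm M (\<lambda>i. if i < k then e i else e (g (i - k) + k)) t"
  by (induction t) auto

lemma sat_ren_fm:
  "sat M e (ren_fm k g p) \<longleftrightarrow> sat M (\<lambda>i. if i < k then e i else e (g (i - k) + k)) p"
proof (induction p arbitrary: k e)
  case (All p)
  have "(\<lambda>i. if i < Suc k then case_nat x e i else case_nat x e (g (i - Suc k) + Suc k)) =
      case_nat x (\<lambda>i. if i < k then e i else e (g (i - k) + k))" for x
    by (auto split: nat.split)
  then show ?case by (simp add: All.IH)
qed (auto simp: eval_ren_tm)

text \<open>Permits the variables of a definable predicate to be permuted or identified.
  \<open>\<sigma>\<close> is typically a \<open>case_nat\<close> expression over \<open>e\<close>,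
  and \<open>g\<close> is the matching map of indices.\<close>

lemma definable_ren:
  assumes "definable L X" "\<And>e i. \<sigma> e i = e (g i)"
  shows "definable L (\<lambda>M e. X M (\<sigma> e))"
proof -
  obtain p where "fm_in L p" "\<And>M e. sat M e p \<longleftrightarrow> X M e"
    using assms by (auto simp: definable_def)
  moreover have "\<sigma> e = (\<lambda>i. e (g i))" for e using assms(2) by auto
  ultimately show ?thesis using definable_fm[of L "ren_fm 0 g p"] by (simp add: sat_ren_fm)
qed

lemma definable_eq: "tm_in L t \<Longrightarrow> tm_in L u \<Longrightarrow> definable L (\<lambda>M e. eval_tm M e t = eval_tm M e u)"
  using definable_fm[of L "Eq t u"] by simp

lemma definable_rel:
  "R \<in> rels_of L \<Longrightarrow> tm_in L t \<Longrightarrow> tm_in L u \<Longrightarrow>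
    definable L (\<lambda>M e. rel_of M R (eval_tm M e t) (eval_tm M e u))"
  using definable_fm[of L "Rel R t u"] by simp

lemma definable_eq_var: "definable L (\<lambda>M e. e i = e j)"
  using definable_eq[of L "Var i" "Var j"] by simp

lemma definable_ball_finite:
  "(\<And>i. i < (m::nat) \<Longrightarrow> definable L (X i)) \<Longrightarrow> definable L (\<lambda>M e. \<forall>i<m. X i M e)"
proof (induction m)
  case 0
  have "definable L (\<lambda>M e. e 0 = e 0)" by (rule definable_eq_var)
  then show ?case by simp
next
  case (Suc m)
  then have "definable L (\<lambda>M e. X m M e \<and> (\<forall>i<m. X i M e))"
    by (intro definable_conj) auto
  then show ?case by (auto simp: less_Suc_eq_le le_less all_conj_distrib imp_disjL conj_commute
      elim!: back_subst[of "definable L"])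
qed

text \<open>Composition quantifies over as many intermediate values as there are inner functions;
  these occupy the first \<open>m\<close> indices.\<close>

lemma definable_ex_list:
  "definable L X \<Longrightarrow>
    definable L (\<lambda>M e. \<exists>zs. length zs = m \<and> X M (\<lambda>i. if i < m then zs ! i else e (i - m)))"
proof (induction m arbitrary: X)
  case 0
  then show ?case by simp
next
  case (Suc m)
  have eq: "(\<exists>zs. length zs = Suc m \<and> X M (\<lambda>i. if i < Suc m then zs ! i else e (i - Suc m))) \<longleftrightarrow>
      (\<exists>zs. length zs = m \<and> (\<exists>z. X M (case_nat z (\<lambda>i. if i < m then zs ! i else e (i - m)))))"
    (is "?l \<longleftrightarrow> ?r") for M e
  proof -
    have env: "(\<lambda>i. if i < Suc m then (z # zs) ! i else e (i - Suc m)) =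
        case_nat z (\<lambda>i. if i < m then zs ! i else e (i - m))" for z zs
      by (auto split: nat.split)
    show ?thesis by (simp add: length_Suc_conv env ex_simps[symmetric] del: ex_simps) blast
  qed
  have "definable L (\<lambda>M e. X M (case_nat (e 0) (\<lambda>i. e (Suc i))))"
    by (rule definable_ren[OF Suc.prems, where g = "\<lambda>i. i"]) (auto split: nat.split)
  then have "definable L (\<lambda>M e. \<exists>z. X M (case_nat z e))" by (intro definable_ex)
  from Suc.IH[OF this] show ?case unfolding eq .
qed


section \<open>Coding of finite tables by strings\<close>

text \<open>The block \<open>p\<close> is delimited by \<open>22\<close>. Only factors, segments and
  added digits occur, because only these can be expressed in the theories. The last two conditions
  may refer to different occurrences of \<open>2\<close> in \<open>p\<close>; in the tables built
  below each block has just one.\<close>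

definition coded :: "str \<Rightarrow> str \<Rightarrow> str \<Rightarrow> bool" where
  "coded i r h \<longleftrightarrow> (\<exists>p. sublist ([Two, Two] @ p @ [Two, Two]) h \<and> \<not> sublist [Two, Two] p \<and>
     prefix (i @ [One, Two]) p \<and> suffix ([Two, One] @ r) p)"

definition block_list :: "str list \<Rightarrow> str" where
  "block_list ps = concat (map (\<lambda>p. [Two, Two] @ p) ps) @ [Two, Two]"

definition block :: "str \<Rightarrow> bool" where
  "block p \<longleftrightarrow> p \<noteq> [] \<and> hd p = One \<and> last p = One \<and> \<not> sublist [Two, Two] p"

lemma block_list_Cons: "block_list (p # ps) = Two # Two # p @ block_list ps"
  by (simp add: block_list_def)

lemma block_list_Two_Two: "\<exists>w. block_list ps = Two # Two # w"
  by (cases ps) (auto simp: block_list_def)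

text \<open>A delimiter cannot begin inside a block: the remainder \<open>us\<close> would either be
  the single digit \<open>2\<close>, against the last digit of the block, or begin with
  \<open>22\<close>, which a block does not contain.\<close>

lemma overlap_Nil:
  assumes "suffix us q" "block q" "us @ Two # Two # w = Two # Two # z"
  shows "us = []"
proof (cases us)
  case (Cons a vs)
  show ?thesis
  proof (cases vs)
    case Nil
    then have "last q = Two" using assms Cons by (auto simp: suffix_def)
    then show ?thesis using assms by (simp add: block_def)
  next
    case (Cons b ws)
    then have "us = Two # Two # ws" using assms \<open>us = a # vs\<close> by simp
    then have "sublist [Two, Two] q" using assms(1) by (auto simp: suffix_def sublist_def)
    then show ?thesis using assms by (simp add: block_def)
  qed
qed simp

text \<open>A block contains no \<open>22\<close> and begins and ends with \<open>1\<close>, so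
  \<open>22\<close> occurs only as a delimiter. The induction distinguishes whether the opening
  \<open>22\<close> of the factor starts at the first digit, at the second, or beyond the first
  delimiter.\<close>

lemma delimited_factor:
  assumes "\<forall>q\<in>set ps. block q" "\<not> sublist [Two, Two] p"
    "xs @ [Two, Two] @ p @ [Two, Two] @ ys = block_list ps"
  shows "p \<in> set ps"
  using assms
proof (induction ps arbitrary: xs)
  case Nil
  then have "length (xs @ [Two, Two] @ p @ [Two, Two] @ ys) = 2" by (simp add: block_list_def)
  then show ?case by simp
next
  case (Cons q ps)
  obtain w where w: "block_list ps = Two # Two # w" using block_list_Two_Two by blast
  have q: "block q" using Cons.prems by simp
  have eq: "xs @ Two # Two # p @ Two # Two # ys = Two # Two # q @ block_list ps"
    using Cons.prems(3) by (simp add: block_list_Cons)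
  consider "xs = []" | a where "xs = [a]" | xs' where "xs = Two # Two # xs'"
    using eq by (cases xs rule: remdups_adj.cases) auto
  then show ?case
  proof cases
    case 1
    then have "p @ Two # Two # ys = q @ Two # Two # w" using eq w by simp
    then consider us where "p @ us = q" "Two # Two # ys = us @ Two # Two # w"
      | us where "p = q @ us" "us @ Two # Two # ys = Two # Two # w"
      by (auto simp: append_eq_append_conv2)
    then show ?thesis
    proof cases
      case (1 us)
      then have "us = []" using overlap_Nil[OF _ q, of us] by (metis suffixI)
      then show ?thesis using 1 by simp
    next
      case (2 us)
      show ?thesis
      proof (cases us)
        case Nil
        then show ?thesis using 2 by simp
      next
        case (Cons a vs)
        show ?thesis
        proof (cases vs)
          case Nil
          \<comment> \<open>The closing \<open>22\<close> of \<open>p\<close> would start at the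
            second digit of a delimiter, so the next block would begin with
            \<open>2\<close>.\<close>
          then have "Two # ys = w" using 2 Cons by simp
          then have "\<exists>q' ps'. ps = q' # ps' \<and> hd (q' @ block_list ps') = Two"
            using w by (cases ps) (auto simp: block_list_def)
          then show ?thesis using Cons.prems(1) by (auto simp: block_def)
        next
          case (Cons b ws)
          then have "us = [Two, Two] @ ws" using 2 \<open>us = a # vs\<close> by simp
          then have "sublist [Two, Two] p" using 2 by (metis sublist_appendI append.assoc)
          then show ?thesis using Cons.prems by simp
        qed
      qed
    qed
  next
    case (2 a)
    then have "hd (q @ block_list ps) = Two" using eq by (metis append_Cons append_Nil list.sel(1,3))
    then show ?thesis using q by (simp add: block_def)
  next
    case (3 xs')
    then have "xs' @ Two # Two # p @ Two # Two # ys = q @ Two # Two # w" using eq w by simp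
    then consider us where "xs' @ us = q" "us @ Two # Two # w = Two # Two # p @ Two # Two # ys"
      | us where "xs' = q @ us" "us @ Two # Two # p @ Two # Two # ys = block_list ps"
      using w by (auto simp: append_eq_append_conv2)
    then show ?thesis
    proof cases
      case (1 us)
      then have "us = []" using overlap_Nil[OF _ q, of us] by (metis suffixI)
      then have "[] @ [Two, Two] @ p @ [Two, Two] @ ys = block_list ps" using 1 w by simp
      then have "p \<in> set ps" using Cons.prems by (intro Cons.IH) auto
      then show ?thesis by simp
    next
      case (2 us)
      then have "us @ [Two, Two] @ p @ [Two, Two] @ ys = block_list ps" by simp
      then have "p \<in> set ps" using Cons.prems by (intro Cons.IH) auto
      then show ?thesis by simp
    qed
  qed
qed

lemma sublist_block_list:
  "p \<in> set ps \<Longrightarrow> sublist ([Two, Two] @ p @ [Two, Two]) (block_list ps)"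
proof (induction ps)
  case (Cons q ps)
  obtain w where w: "block_list ps = Two # Two # w" using block_list_Two_Two by blast
  show ?case
  proof (cases "p = q")
    case True
    have "block_list (q # ps) = [] @ ([Two, Two] @ p @ [Two, Two]) @ w"
      using True w by (simp add: block_list_Cons)
    then show ?thesis unfolding sublist_def by blast
  next
    case False
    then have "sublist ([Two, Two] @ p @ [Two, Two]) (block_list ps)" using Cons by simp
    moreover have "sublist (block_list ps) (block_list (q # ps))"
      unfolding sublist_def block_list_Cons by (metis append_Cons append_Nil2 append_Nil)
    ultimately show ?thesis using sublist_order.order.trans by blast
  qed
qed simp

section \<open>Tables of unary numerals\<close>

text \<open>The exponents exceed the numbers by one so that a block begins and ends with
  \<open>1\<close> even when index or value is 0, as \<open>block\<close> demands. This is the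
  source of the extra \<open>One\<close> on each side of the separator in
  \<open>coded\<close>.\<close>

definition pair_block :: "nat \<Rightarrow> nat \<Rightarrow> str" where
  "pair_block i r = replicate (Suc i) One @ Two # replicate (Suc r) One"

lemma block_pair_block: "block (pair_block i r)"
proof -
  have "\<not> sublist [Two, Two] (pair_block i r)"
  proof
    assume "sublist [Two, Two] (pair_block i r)"
    then obtain us vs where "pair_block i r = us @ Two # Two # vs" by (auto simp: sublist_def)
    then have "Two # vs = replicate (Suc r) One"
      unfolding pair_block_def by (subst (asm) append_Cons_eq_iff) auto
    then show False by simp
  qed
  then show ?thesis by (simp add: block_def pair_block_def)
qed

lemma prefix_pair_block: "prefix (i @ [One, Two]) (pair_block j r) \<longleftrightarrow> i = replicate j One"
proof
  assume "prefix (i @ [One, Two]) (pair_block j r)"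
  then obtain u where "replicate (Suc j) One @ Two # replicate (Suc r) One = (i @ [One]) @ Two # u"
    by (auto simp: prefix_def pair_block_def)
  then have "i @ [One] = replicate (Suc j) One"
    by (subst (asm) append_Cons_eq_iff) auto
  then show "i = replicate j One" by (simp add: replicate_append_same[symmetric])
qed (simp add: pair_block_def replicate_append_same[symmetric])

lemma suffix_pair_block: "suffix ([Two, One] @ r) (pair_block i k) \<longleftrightarrow> r = replicate k One"
proof
  assume "suffix ([Two, One] @ r) (pair_block i k)"
  then obtain u where "replicate (Suc i) One @ Two # replicate (Suc k) One = u @ Two # (One # r)"
    by (auto simp: suffix_def pair_block_def)
  then show "r = replicate k One"
    by (subst (asm) append_Cons_eq_iff) auto
qed (auto simp: pair_block_def suffix_def)

definition table_string :: "(nat \<Rightarrow> nat) \<Rightarrow> nat \<Rightarrow> str" where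
  "table_string f k = block_list (map (\<lambda>j. pair_block j (f j)) [0..<Suc k])"

lemma coded_table_string:
  "coded i r (table_string f k) \<longleftrightarrow> (\<exists>j\<le>k. i = replicate j One \<and> r = replicate (f j) One)"
proof
  assume "coded i r (table_string f k)"
  then obtain p where p: "sublist ([Two, Two] @ p @ [Two, Two]) (table_string f k)"
    "\<not> sublist [Two, Two] p" "prefix (i @ [One, Two]) p" "suffix ([Two, One] @ r) p"
    by (auto simp: coded_def)
  let ?ps = "map (\<lambda>j. pair_block j (f j)) [0..<Suc k]"
  obtain xs ys where "xs @ [Two, Two] @ p @ [Two, Two] @ ys = block_list ?ps"
    using p(1) by (auto simp: sublist_def table_string_def)
  then have "p \<in> set ?ps"
    using p(2) by (intro delimited_factor) (auto simp: block_pair_block)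
  then obtain j where "j \<le> k" "p = pair_block j (f j)"
    by (auto simp: less_Suc_eq_le simp del: upt_Suc)
  then show "\<exists>j\<le>k. i = replicate j One \<and> r = replicate (f j) One"
    using p(3,4) by (auto simp: prefix_pair_block suffix_pair_block simp del: append.simps)
next
  assume "\<exists>j\<le>k. i = replicate j One \<and> r = replicate (f j) One"
  then obtain j where j: "j \<le> k" "i = replicate j One" "r = replicate (f j) One" by blast
  have "sublist ([Two, Two] @ pair_block j (f j) @ [Two, Two]) (table_string f k)"
    unfolding table_string_def using j
    by (intro sublist_block_list) (auto simp: less_Suc_eq_le simp del: upt_Suc)
  then show "coded i r (table_string f k)"
    unfolding coded_def using j block_pair_block[of j "f j"] prefix_pair_block suffix_pair_block
    by (auto simp: block_def)
qed


section \<open>Representability of recursive functions\<close>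

definition value_of :: "'a struct \<Rightarrow> tm \<Rightarrow> 'a" where
  "value_of M t = eval_tm M (\<lambda>_. undefined) t"

lemma eval_closed: "tm_below 0 t \<Longrightarrow> eval_tm M e t = value_of M t"
  unfolding value_of_def by (rule eval_tm_cong) auto

text \<open>\<open>P\<close> and \<open>Q\<close> stand for initial and end segments, \<open>R d x y\<close> and \<open>Lf d x y\<close> for
  \<open>y\<close> being \<open>x\<close> with the digit \<open>d\<close> appended on the right or on the left. On nonstandard
  elements only \<open>R_P\<close> and \<open>Lf_Q\<close> are required.\<close>

locale string_theory =
  fixes L :: lang and T :: "fm set" and nm :: "str \<Rightarrow> tm"
    and P Q :: "nat struct \<Rightarrow> nat \<Rightarrow> nat \<Rightarrow> bool"
    and R Lf :: "digit \<Rightarrow> nat struct \<Rightarrow> nat \<Rightarrow> nat \<Rightarrow> bool"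
  assumes T: "T \<subseteq> sentences L"
    and nm_in: "tm_in L (nm s)" and nm_below: "tm_below 0 (nm s)"
    and nm_code: "computable 1 (\<lambda>xs. tm_code (nm (replicate (xs ! 0) One)))"
    and distinct: "s \<noteq> t \<Longrightarrow> Neg (Eq (nm s) (nm t)) \<in> T"
    and definable_P: "definable L (\<lambda>M e. P M (e i) (e j))"
    and definable_Q: "definable L (\<lambda>M e. Q M (e i) (e j))"
    and definable_R: "definable L (\<lambda>M e. R d M (e i) (e j))"
    and definable_Lf: "definable L (\<lambda>M e. Lf d M (e i) (e j))"
    and P_nm: "models M T \<Longrightarrow>
      P M x (value_of M (nm t)) \<longleftrightarrow> (\<exists>s. prefix s t \<and> x = value_of M (nm s))"
    and Q_nm: "models M T \<Longrightarrow>
      Q M x (value_of M (nm t)) \<longleftrightarrow> (\<exists>s. suffix s t \<and> x = value_of M (nm s))"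
    and R_nm: "models M T \<Longrightarrow> R d M (value_of M (nm s)) y \<longleftrightarrow> y = value_of M (nm (s @ [d]))"
    and Lf_nm: "models M T \<Longrightarrow> Lf d M (value_of M (nm s)) y \<longleftrightarrow> y = value_of M (nm (d # s))"
    and R_P: "models M T \<Longrightarrow> R d M x y \<Longrightarrow> P M x y"
    and Lf_Q: "models M T \<Longrightarrow> Lf d M x y \<Longrightarrow> Q M x y"
begin

section \<open>Standard elements and entries of tables inside a model\<close>

abbreviation cst :: "nat struct \<Rightarrow> str \<Rightarrow> nat" where
  "cst M s \<equiv> value_of M (nm s)"

abbreviation num :: "nat struct \<Rightarrow> nat \<Rightarrow> nat" where
  "num M n \<equiv> cst M (replicate n One)"

lemma definable_cst: "definable L (\<lambda>M e. e i = cst M s)"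
  using definable_eq[of L "Var i" "nm s"] nm_in nm_below by (simp add: eval_closed)

lemma cst_eq [simp]: "models M T \<Longrightarrow> cst M s = cst M t \<longleftrightarrow> s = t"
  using distinct[of s t] nm_below by (fastforce simp: models_def eval_closed)

text \<open>\<open>R_P\<close> puts \<open>x\<close> among the initial segments of a standard
  element, which \<open>P_nm\<close> enumerates, so \<open>x\<close> is standard; only then can
  \<open>R_nm\<close> be applied.\<close>

lemma R_cst: "models M T \<Longrightarrow> R d M x (cst M t) \<longleftrightarrow> (\<exists>s. x = cst M s \<and> t = s @ [d])"
  using R_P[of M d x "cst M t"] P_nm[of M x t] R_nm[of M d] by (metis cst_eq)

lemma Lf_cst: "models M T \<Longrightarrow> Lf d M x (cst M t) \<longleftrightarrow> (\<exists>s. x = cst M s \<and> t = d # s)"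
  using Lf_Q[of M d x "cst M t"] Q_nm[of M x t] Lf_nm[of M d] by (metis cst_eq)

text \<open>\<open>a\<close>, \<open>b\<close>, \<open>a'\<close>, \<open>b'\<close> stand for
  \<open>p2\<close>, \<open>p22\<close>, \<open>2p22\<close>, \<open>22p22\<close>, and
  \<open>v\<close> is an initial segment of \<open>h\<close> that ends with the last of
  them.\<close>

definition delimited :: "nat struct \<Rightarrow> nat \<Rightarrow> nat \<Rightarrow> bool" where
  "delimited M p h \<longleftrightarrow> (\<exists>a b a' b' v. R Two M p a \<and> R Two M a b \<and> Lf Two M b a' \<and> Lf Two M a' b' \<and>
     Q M b' v \<and> P M v h)"

text \<open>The counterpart of \<open>coded\<close> inside a model. Its behaviour on a nonstandard
  \<open>h\<close> is unknown, which \<open>represents_prec\<close> tolerates.\<close>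

definition entry :: "nat struct \<Rightarrow> nat \<Rightarrow> nat \<Rightarrow> nat \<Rightarrow> bool" where
  "entry M i r h \<longleftrightarrow> (\<exists>p. delimited M p h \<and>
     \<not> (\<exists>k v. k = cst M [Two, Two] \<and> Q M k v \<and> P M v p) \<and>
     (\<exists>a b. R One M i a \<and> R Two M a b \<and> P M b p) \<and>
     (\<exists>a b. Lf One M r a \<and> Lf Two M a b \<and> Q M b p))"

lemma definable_entry: "definable L (\<lambda>M e. entry M (e i) (e j) (e k))"
  unfolding entry_def delimited_def
  by (intro definable_intros definable_P definable_Q definable_R definable_Lf definable_cst)

lemma sublist_iff: "sublist s t \<longleftrightarrow> (\<exists>u. suffix s u \<and> prefix u t)"
  unfolding sublist_def suffix_def prefix_def by (metis append.assoc)

lemma delimited_cst: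
  assumes "models M T"
  shows "delimited M p (cst M h) \<longleftrightarrow>
    (\<exists>s. p = cst M s \<and> sublist ([Two, Two] @ s @ [Two, Two]) h)"
proof
  assume "delimited M p (cst M h)"
  then obtain a b a' b' v where *: "R Two M p a" "R Two M a b" "Lf Two M b a'" "Lf Two M a' b'"
    "Q M b' v" "P M v (cst M h)"
    unfolding delimited_def by blast
  \<comment> \<open>Read backwards from \<open>h\<close>, every element of the chain is a segment or
    a predecessor of a standard one, so standardness passes down to \<open>p\<close>.\<close>
  obtain v' where v: "v = cst M v'" "prefix v' h" using *(6) P_nm assms by blast
  obtain w where w: "b' = cst M w" "suffix w v'" using *(5) v Q_nm assms by blast
  obtain w1 where w1: "a' = cst M w1" "w = Two # w1" using *(4) w Lf_cst assms by blast
  obtain w2 where w2: "b = cst M w2" "w1 = Two # w2" using *(3) w1 Lf_cst assms by blast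
  obtain w3 where w3: "a = cst M w3" "w2 = w3 @ [Two]" using *(2) w2 R_cst assms by blast
  obtain s where "p = cst M s" "w3 = s @ [Two]" using *(1) w3 R_cst assms by blast
  then show "\<exists>s. p = cst M s \<and> sublist ([Two, Two] @ s @ [Two, Two]) h"
    using v w w1 w2 w3 by (auto simp: sublist_iff)
next
  assume "\<exists>s. p = cst M s \<and> sublist ([Two, Two] @ s @ [Two, Two]) h"
  then obtain s u where *: "p = cst M s" "suffix ([Two, Two] @ s @ [Two, Two]) u" "prefix u h"
    by (auto simp: sublist_iff)
  then have "R Two M p (cst M (s @ [Two]))" "R Two M (cst M (s @ [Two])) (cst M (s @ [Two, Two]))"
    "Lf Two M (cst M (s @ [Two, Two])) (cst M (Two # s @ [Two, Two]))"
    "Lf Two M (cst M (Two # s @ [Two, Two])) (cst M (Two # Two # s @ [Two, Two]))"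
    "Q M (cst M (Two # Two # s @ [Two, Two])) (cst M u)" "P M (cst M u) (cst M h)"
    using assms R_nm Lf_nm P_nm Q_nm by auto
  then show "delimited M p (cst M h)" unfolding delimited_def by blast
qed

text \<open>\<open>x\<close> and \<open>y\<close> range over the whole model, so a standard table
  has no nonstandard entries. Otherwise the clause about all entries in
  \<open>represents_prec\<close> could fail for a correct table.\<close>

lemma entry_cst:
  assumes "models M T"
  shows "entry M x y (cst M h) \<longleftrightarrow> (\<exists>i r. x = cst M i \<and> y = cst M r \<and> coded i r h)"
proof -
  have no22: "(\<exists>k v. k = cst M [Two, Two] \<and> Q M k v \<and> P M v (cst M s)) \<longleftrightarrow> sublist [Two, Two] s" for s
  proof -
    have "Q M (cst M [Two, Two]) (cst M u) \<longleftrightarrow> suffix [Two, Two] u" for u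
      using assms Q_nm by auto
    then show ?thesis using assms P_nm by (auto simp: sublist_iff)
  qed
  have left: "(\<exists>a b. R One M x a \<and> R Two M a b \<and> P M b (cst M s)) \<longleftrightarrow>
      (\<exists>i. x = cst M i \<and> prefix (i @ [One, Two]) s)" (is "?l \<longleftrightarrow> ?r") for s
  proof
    assume ?l
    then obtain a b where *: "R One M x a" "R Two M a b" "P M b (cst M s)" by blast
    obtain w where w: "b = cst M w" "prefix w s" using *(3) P_nm assms by blast
    obtain w1 where w1: "a = cst M w1" "w = w1 @ [Two]" using *(2) w R_cst assms by blast
    obtain i where "x = cst M i" "w1 = i @ [One]" using *(1) w1 R_cst assms by blast
    then show ?r using w w1 by auto
  next
    assume ?r
    then obtain i where "x = cst M i" "prefix (i @ [One, Two]) s" by blast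
    then have "R One M x (cst M (i @ [One]))" "R Two M (cst M (i @ [One])) (cst M (i @ [One, Two]))"
      "P M (cst M (i @ [One, Two])) (cst M s)"
      using assms R_nm P_nm by auto
    then show ?l by blast
  qed
  have right: "(\<exists>a b. Lf One M y a \<and> Lf Two M a b \<and> Q M b (cst M s)) \<longleftrightarrow>
      (\<exists>r. y = cst M r \<and> suffix ([Two, One] @ r) s)" (is "?l \<longleftrightarrow> ?r") for s
  proof
    assume ?l
    then obtain a b where *: "Lf One M y a" "Lf Two M a b" "Q M b (cst M s)" by blast
    obtain w where w: "b = cst M w" "suffix w s" using *(3) Q_nm assms by blast
    obtain w1 where w1: "a = cst M w1" "w = Two # w1" using *(2) w Lf_cst assms by blast
    obtain i where "y = cst M i" "w1 = One # i" using *(1) w1 Lf_cst assms by blast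
    then show ?r using w w1 by auto
  next
    assume ?r
    then obtain r where "y = cst M r" "suffix ([Two, One] @ r) s" by blast
    then have "Lf One M y (cst M (One # r))" "Lf Two M (cst M (One # r)) (cst M (Two # One # r))"
      "Q M (cst M (Two # One # r)) (cst M s)"
      using assms Lf_nm Q_nm by auto
    then show ?l by blast
  qed
  show ?thesis
  proof
    assume "entry M x y (cst M h)"
    then obtain p where p: "delimited M p (cst M h)"
      "\<not> (\<exists>k v. k = cst M [Two, Two] \<and> Q M k v \<and> P M v p)"
      "\<exists>a b. R One M x a \<and> R Two M a b \<and> P M b p"
      "\<exists>a b. Lf One M y a \<and> Lf Two M a b \<and> Q M b p"
      unfolding entry_def by blast
    obtain s where "p = cst M s" "sublist ([Two, Two] @ s @ [Two, Two]) h"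
      using p(1) delimited_cst[OF assms] by blast
    then show "\<exists>i r. x = cst M i \<and> y = cst M r \<and> coded i r h"
      using p(2-4) unfolding coded_def by (metis no22 left right)
  next
    assume "\<exists>i r. x = cst M i \<and> y = cst M r \<and> coded i r h"
    then obtain i r s where *: "x = cst M i" "y = cst M r"
      "sublist ([Two, Two] @ s @ [Two, Two]) h" "\<not> sublist [Two, Two] s"
      "prefix (i @ [One, Two]) s" "suffix ([Two, One] @ r) s"
      unfolding coded_def by blast
    have "delimited M (cst M s) (cst M h)" using * delimited_cst[OF assms] by blast
    moreover have "\<not> (\<exists>k v. k = cst M [Two, Two] \<and> Q M k v \<and> P M v (cst M s))"
      using * by (simp only: no22 not_False_eq_True)
    moreover have "\<exists>a b. R One M x a \<and> R Two M a b \<and> P M b (cst M s)"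
      using * left by blast
    moreover have "\<exists>a b. Lf One M y a \<and> Lf Two M a b \<and> Q M b (cst M s)"
      using * right by blast
    ultimately show "entry M x y (cst M h)" unfolding entry_def by blast
  qed
qed

lemma entry_table_string:
  "models M T \<Longrightarrow> entry M x y (cst M (table_string f k)) \<longleftrightarrow> (\<exists>j\<le>k. x = num M j \<and> y = num M (f j))"
  by (auto simp: entry_cst coded_table_string)

lemma R_num: "models M T \<Longrightarrow> R One M (num M i) y \<longleftrightarrow> y = num M (Suc i)"
  by (simp add: R_nm replicate_append_same)

lemma R_num_Suc: "models M T \<Longrightarrow> R One M x (num M (Suc i)) \<longleftrightarrow> x = num M i"
proof -
  have "replicate (Suc i) One = s @ [One] \<longleftrightarrow> s = replicate i One" for s
    by (subst replicate_Suc, subst replicate_append_same[symmetric]) auto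
  then show "models M T \<Longrightarrow> ?thesis" by (simp add: R_cst del: replicate.simps)
qed

lemma P_num: "models M T \<Longrightarrow> P M x (num M k) \<longleftrightarrow> (\<exists>j\<le>k. x = num M j)"
proof -
  have "prefix s (replicate k One) \<longleftrightarrow> (\<exists>j\<le>k. s = replicate j One)" for s
  proof
    assume "prefix s (replicate k One)"
    then obtain us where "replicate k One = s @ us" by (auto simp: prefix_def)
    then have "s = take (length s) (replicate k One)" by simp
    then have "s = replicate (min (length s) k) One" by simp
    then show "\<exists>j\<le>k. s = replicate j One" by (meson min.cobounded2)
  next
    assume "\<exists>j\<le>k. s = replicate j One"
    then show "prefix s (replicate k One)"
      by (metis le_add_diff_inverse replicate_add prefixI)
  qed
  then show "models M T \<Longrightarrow> ?thesis" by (auto simp: P_nm)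
qed

section \<open>Representing formulas for the schemes of recursion\<close>

text \<open>Slot 0 holds the value, slots 1 to \<open>n\<close> the arguments. As \<open>e 0\<close>
  is an arbitrary element, the equivalence includes uniqueness of the value among nonstandard
  elements.\<close>

definition represents :: "nat \<Rightarrow> (nat struct \<Rightarrow> (nat \<Rightarrow> nat) \<Rightarrow> bool) \<Rightarrow> (nat list \<Rightarrow> nat) \<Rightarrow> bool" where
  "represents n X f \<longleftrightarrow> definable L X \<and>
     (\<forall>M xs e. models M T \<longrightarrow> length xs = n \<longrightarrow> (\<forall>i<n. e (Suc i) = num M (xs ! i)) \<longrightarrow>
       (X M e \<longleftrightarrow> e 0 = num M (f xs)))"

lemma representsD:
  assumes "represents n X f" "models M T" "length xs = n" "\<And>i. i < n \<Longrightarrow> e (Suc i) = num M (xs ! i)"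
  shows "X M e \<longleftrightarrow> e 0 = num M (f xs)"
  using assms by (auto simp: represents_def)

lemma represents_zero: "represents n (\<lambda>M e. e 0 = num M 0) (\<lambda>xs. 0)"
  unfolding represents_def using definable_cst by auto

lemma represents_succ: "represents 1 (\<lambda>M e. R One M (e 1) (e 0)) (\<lambda>xs. Suc (xs ! 0))"
  unfolding represents_def using definable_R R_num by simp

lemma represents_proj: "i < n \<Longrightarrow> represents n (\<lambda>M e. e 0 = e (Suc i)) (\<lambda>xs. xs ! i)"
  unfolding represents_def using definable_eq_var by simp

lemma represents_comp:
  assumes f: "represents (length gs) X f"
    and g: "\<And>g. g \<in> set gs \<Longrightarrow> \<exists>Y. represents n Y g"
  shows "\<exists>Z. represents n Z (\<lambda>xs. f (map (\<lambda>g. g xs) gs))"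
proof -
  let ?m = "length gs"
  have "\<forall>i. \<exists>Y. i < ?m \<longrightarrow> represents n Y (gs ! i)" using g nth_mem by blast
  then obtain Y where Y: "\<And>i. i < ?m \<Longrightarrow> represents n (Y i) (gs ! i)" by metis
  \<comment> \<open>The values of the inner functions fill the slots below \<open>?m\<close>; the
    result moves to slot \<open>?m\<close> and the arguments follow it.\<close>
  define Z where "Z M e \<longleftrightarrow> (\<exists>zs. length zs = ?m \<and>
      (\<lambda>e. (\<forall>i<?m. Y i M (case_nat (e i) (\<lambda>j. e (?m + Suc j)))) \<and> X M (case_nat (e ?m) e))
      (\<lambda>i. if i < ?m then zs ! i else e (i - ?m)))" for M e
  have "represents n Z (\<lambda>xs. f (map (\<lambda>g. g xs) gs))"
    unfolding represents_def
  proof (intro conjI allI impI)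
    have dY: "definable L (Y i)" if "i < ?m" for i using Y that by (simp add: represents_def)
    have dX: "definable L X" using f by (simp add: represents_def)
    have "definable L (\<lambda>M e. Y i M (case_nat (e i) (\<lambda>j. e (?m + Suc j))))" if "i < ?m" for i
      by (rule definable_ren[OF dY[OF that], where g = "case_nat i (\<lambda>j. ?m + Suc j)"])
        (simp split: nat.split)
    moreover have "definable L (\<lambda>M e. X M (case_nat (e ?m) e))"
      by (rule definable_ren[OF dX, where g = "case_nat ?m (\<lambda>j. j)"]) (simp split: nat.split)
    ultimately have "definable L (\<lambda>M e. (\<forall>i<?m. Y i M (case_nat (e i) (\<lambda>j. e (?m + Suc j)))) \<and>
        X M (case_nat (e ?m) e))"
      by (intro definable_conj definable_ball_finite) auto
    from definable_ex_list[OF this, of ?m] show "definable L Z" unfolding Z_def .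
  next
    fix M xs e
    assume M: "models M T" and xs: "length xs = n" "\<forall>i<n. e (Suc i) = num M (xs ! i)"
    have Y': "Y i M (case_nat z (\<lambda>j. e (Suc j))) \<longleftrightarrow> z = num M ((gs ! i) xs)" if "i < ?m" for i z
      using representsD[OF Y[OF that] M xs(1), of "case_nat z (\<lambda>j. e (Suc j))"] xs(2) by simp
    have "X M (case_nat (e 0) (\<lambda>i. if i < ?m then zs ! i else e (i - ?m))) \<longleftrightarrow>
        e 0 = num M (f (map (\<lambda>g. g xs) gs))"
      if "length zs = ?m" "\<forall>i<?m. zs ! i = num M ((gs ! i) xs)" for zs
      using representsD[OF f M, of "map (\<lambda>g. g xs) gs"
          "case_nat (e 0) (\<lambda>i. if i < ?m then zs ! i else e (i - ?m))"] that by simp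
    moreover have "\<exists>zs. length zs = ?m \<and> (\<forall>i<?m. zs ! i = num M ((gs ! i) xs))"
      by (intro exI[of _ "map (\<lambda>g. num M (g xs)) gs"]) simp
    ultimately show "Z M e \<longleftrightarrow> e 0 = num M (f (map (\<lambda>g. g xs) gs))"
      unfolding Z_def by (simp add: Y' cong: conj_cong) blast
  qed
  then show ?thesis by blast
qed

text \<open>A table that has an entry for \<open>k\<close>, and each of whose entries is justified by an entry with
  the preceding index, is correct up to \<open>k\<close>, even if the table is nonstandard.\<close>

lemma represents_prec:
  assumes f: "represents n X f" and g: "represents (Suc (Suc n)) Y g"
  shows "\<exists>Z. represents (Suc n) Z (\<lambda>xs. rec_nat (f (tl xs)) (\<lambda>k r. g (k # r # tl xs)) (hd xs))"
proof -
  \<comment> \<open>Slot 0 is the result, slot 1 the recursion argument, and the parameters start at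
    slot 2.\<close>
  define Z where "Z M e \<longleftrightarrow> (\<exists>h. entry M (e 1) (e 0) h \<and> (\<forall>j r'. entry M j r' h \<longrightarrow>
      (j = num M 0 \<and> X M (case_nat r' (\<lambda>i. e (Suc (Suc i))))) \<or>
      (\<exists>i r. R One M i j \<and> entry M i r h \<and>
        Y M (case_nat r' (case_nat i (case_nat r (\<lambda>i. e (Suc (Suc i)))))))))" for M e
  have "represents (Suc n) Z (\<lambda>xs. rec_nat (f (tl xs)) (\<lambda>k r. g (k # r # tl xs)) (hd xs))"
    unfolding represents_def
  proof (intro conjI allI impI)
    have X: "definable L X" and Y: "definable L Y" using f g by (auto simp: represents_def)
    \<comment> \<open>Three quantifiers (\<open>h\<close>, \<open>j\<close>, \<open>r'\<close>)
      precede \<open>X\<close> and five precede \<open>Y\<close>, so parameter \<open>i\<close>, in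
      slot \<open>Suc (Suc i)\<close>, gets index \<open>i + 5\<close> or
      \<open>i + 7\<close>.\<close>
    show "definable L Z"
      unfolding Z_def
      by (intro definable_intros definable_entry definable_R definable_cst
          definable_ren[OF X, where g = "case_nat 0 (\<lambda>i. Suc (Suc (Suc (Suc (Suc i)))))"]
          definable_ren[OF Y, where g = "case_nat (Suc (Suc 0)) (case_nat (Suc 0) (case_nat 0
            (\<lambda>i. Suc (Suc (Suc (Suc (Suc (Suc (Suc i)))))))))"])
        (simp_all split: nat.split)
  next
    fix M xs e
    assume M: "models M T" and xs: "length xs = Suc n" "\<forall>i<Suc n. e (Suc i) = num M (xs ! i)"
    define k where "k = hd xs"
    define H where "H = rec_nat (f (tl xs)) (\<lambda>k r. g (k # r # tl xs))"
    have e1: "e 1 = num M k" using xs by (auto simp: k_def length_Suc_conv)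
    have tl: "length (tl xs) = n" "\<And>i. i < n \<Longrightarrow> e (Suc (Suc i)) = num M (tl xs ! i)"
      using xs by (auto simp: nth_tl)
    have X: "X M (case_nat r' (\<lambda>i. e (Suc (Suc i)))) \<longleftrightarrow> r' = num M (H 0)" for r'
      using representsD[OF f M tl(1), of "case_nat r' (\<lambda>i. e (Suc (Suc i)))"] tl(2)
      by (simp add: H_def)
    have Y: "Y M (case_nat r' (case_nat (num M i) (case_nat (num M (H i)) (\<lambda>i. e (Suc (Suc i)))))) \<longleftrightarrow>
        r' = num M (H (Suc i))" for r' i
      using representsD[OF g M, of "i # H i # tl xs"
          "case_nat r' (case_nat (num M i) (case_nat (num M (H i)) (\<lambda>i. e (Suc (Suc i)))))"] tl
      by (simp add: H_def nth_Cons split: nat.split)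
    have "Z M e \<longleftrightarrow> e 0 = num M (H k)"
    proof
      assume "Z M e"
      then obtain h where h: "entry M (num M k) (e 0) h"
        and step: "\<And>j r'. entry M j r' h \<Longrightarrow>
          (j = num M 0 \<and> X M (case_nat r' (\<lambda>i. e (Suc (Suc i))))) \<or>
          (\<exists>i r. R One M i j \<and> entry M i r h \<and>
            Y M (case_nat r' (case_nat i (case_nat r (\<lambda>i. e (Suc (Suc i)))))))"
        unfolding Z_def e1 by blast
      have "entry M (num M j) r h \<Longrightarrow> r = num M (H j)" for j r
      proof (induction j arbitrary: r)
        case 0
        \<comment> \<open>The empty string has no predecessor, so only the base clause can justify
          an entry at 0.\<close>
        have "\<not> R One M i (num M 0)" for i using R_cst M by simp
        then show ?case using step[OF 0] X by blast
      next
        case (Suc j)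
        have "num M (Suc j) \<noteq> num M 0" using M by simp
        then obtain i r' where ir: "R One M i (num M (Suc j))" "entry M i r' h"
          "Y M (case_nat r (case_nat i (case_nat r' (\<lambda>i. e (Suc (Suc i))))))"
          using step[OF Suc.prems] by blast
        have "i = num M j" using ir(1) R_num_Suc[OF M] by simp
        moreover have "r' = num M (H j)" using ir(2) Suc.IH calculation by simp
        ultimately show ?case using ir(3) Y by simp
      qed
      then show "e 0 = num M (H k)" using h by blast
    next
      assume e0: "e 0 = num M (H k)"
      let ?h = "cst M (table_string H k)"
      have "entry M (e 1) (e 0) ?h"
        unfolding e0 e1 using M by (auto simp: entry_table_string)
      moreover have "(j = num M 0 \<and> X M (case_nat r' (\<lambda>i. e (Suc (Suc i))))) \<or>
          (\<exists>i r. R One M i j \<and> entry M i r ?h \<and>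
            Y M (case_nat r' (case_nat i (case_nat r (\<lambda>i. e (Suc (Suc i)))))))"
        if jr: "entry M j r' ?h" for j r'
      proof -
        obtain i where i: "i \<le> k" "j = num M i" "r' = num M (H i)"
          using jr M by (auto simp: entry_table_string)
        show ?thesis
        proof (cases i)
          case 0
          then show ?thesis using i X by simp
        next
          case (Suc i')
          then have "R One M (num M i') j" "entry M (num M i') (num M (H i')) ?h"
            using i M R_num by (auto simp: entry_table_string)
          then show ?thesis using Y[of r' i'] i Suc by blast
        qed
      qed
      ultimately show "Z M e" unfolding Z_def by blast
    qed
    then show "Z M e \<longleftrightarrow> e 0 = num M (rec_nat (f (tl xs)) (\<lambda>k r. g (k # r # tl xs)) (hd xs))"
      by (simp add: H_def k_def)
  qed
  then show ?thesis by blast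
qed

text \<open>If every proper initial segment of \<open>y\<close> has a successor among the initial segments of \<open>y\<close>,
  then \<open>y\<close> is a standard numeral or has all of them as initial segments.\<close>

lemma represents_mu:
  assumes f: "represents (Suc n) X f" and ex: "\<And>xs. length xs = n \<Longrightarrow> \<exists>y. f (y # xs) = 0"
  shows "\<exists>Z. represents n Z (\<lambda>xs. LEAST y. f (y # xs) = 0)"
proof -
  \<comment> \<open>\<open>w\<close> names the value 0 that is searched for; a variable is used
    because a definable predicate is applied to slots of an assignment.\<close>
  define Z where "Z M e \<longleftrightarrow> (\<exists>w. w = num M 0 \<and> P M w (e 0) \<and> X M (case_nat w e) \<and>
      (\<forall>z. P M z (e 0) \<and> \<not> z = e 0 \<longrightarrow> \<not> X M (case_nat w (case_nat z (\<lambda>i. e (Suc i)))) \<and>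
        (\<exists>z'. R One M z z' \<and> P M z' (e 0))))" for M e
  have "represents n Z (\<lambda>xs. LEAST y. f (y # xs) = 0)"
    unfolding represents_def
  proof (intro conjI allI impI)
    have X: "definable L X" using f by (auto simp: represents_def)
    show "definable L Z"
      unfolding Z_def
      by (intro definable_intros definable_P definable_R definable_cst definable_eq_var
          definable_ren[OF X, where g = "case_nat 0 (\<lambda>i. Suc i)"]
          definable_ren[OF X, where g = "case_nat (Suc 0) (case_nat 0 (\<lambda>i. Suc (Suc (Suc i))))"])
        (simp_all split: nat.split)
  next
    fix M xs e
    assume M: "models M T" and xs: "length xs = n" "\<forall>i<n. e (Suc i) = num M (xs ! i)"
    define m where "m = (LEAST y. f (y # xs) = 0)"
    have m: "f (m # xs) = 0" unfolding m_def using ex[OF xs(1)] by (rule LeastI_ex)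
    have less_m: "f (j # xs) \<noteq> 0" if "j < m" for j
      using that unfolding m_def by (rule not_less_Least)
    have X: "X M (case_nat (num M 0) (case_nat (num M j) (\<lambda>i. e (Suc i)))) \<longleftrightarrow> f (j # xs) = 0" for j
      using representsD[OF f M, of "j # xs" "case_nat (num M 0) (case_nat (num M j) (\<lambda>i. e (Suc i)))"]
        xs M by (auto simp: nth_Cons split: nat.split)
    have e: "case_nat (e 0) (\<lambda>i. e (Suc i)) = e" by (auto split: nat.split)
    have "Z M e \<longleftrightarrow> e 0 = num M m"
    proof
      assume "Z M e"
      then have Z: "P M (num M 0) (e 0)" "X M (case_nat (num M 0) e)"
        "\<And>z. P M z (e 0) \<Longrightarrow> z \<noteq> e 0 \<Longrightarrow> \<not> X M (case_nat (num M 0) (case_nat z (\<lambda>i. e (Suc i)))) \<and>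
          (\<exists>z'. R One M z z' \<and> P M z' (e 0))"
        unfolding Z_def by blast+
      have not_less: "e 0 \<noteq> num M j" if "j < m" for j
        using X[of j] less_m[OF that] Z(2) e by metis
      \<comment> \<open>The climb from 0: for \<open>j < m\<close> the element \<open>e 0\<close> is
        not \<open>num M j\<close>, since \<open>f\<close> has no zero there, so the successor
        clause yields the next initial segment.\<close>
      have "P M (num M j) (e 0)" if "j \<le> m" for j
        using that
      proof (induction j)
        case 0
        then show ?case using Z by simp
      next
        case (Suc j)
        then show ?case using Z(3)[of "num M j"] not_less[of j] R_num M by force
      qed
      \<comment> \<open>If \<open>num M m\<close> were a proper initial segment of
        \<open>e 0\<close>, the clause on proper segments would deny the zero of \<open>f\<close> at
        \<open>m\<close>.\<close>
      then show "e 0 = num M m" using Z(3)[of "num M m"] X[of m] m by fastforce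
    next
      assume e0: "e 0 = num M m"
      have "P M (num M 0) (e 0)" using M e0 by (auto simp: P_num)
      moreover have "X M (case_nat (num M 0) e)" using X[of m] m e e0 by metis
      moreover have "\<not> X M (case_nat (num M 0) (case_nat z (\<lambda>i. e (Suc i)))) \<and>
          (\<exists>z'. R One M z z' \<and> P M z' (e 0))" if z: "P M z (e 0)" "z \<noteq> e 0" for z
      proof -
        obtain j where j: "z = num M j" "j \<le> m" using z e0 M P_num by auto
        then have "j < m" using z e0 by (cases "j = m") auto
        then show ?thesis using X[of j] less_m[of j] j M R_num P_num e0
          by (metis Suc_leI)
      qed
      ultimately show "Z M e" unfolding Z_def by blast
    qed
    then show "Z M e \<longleftrightarrow> e 0 = num M (LEAST y. f (y # xs) = 0)" by (simp add: m_def)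
  qed
  then show ?thesis by blast
qed

theorem recursive_represented: "recursive n f \<Longrightarrow> \<exists>X. represents n X f"
proof (induction rule: recursive.induct)
  case (comp gs f n)
  then show ?case using represents_comp by blast
next
  case (prec n f g)
  then show ?case using represents_prec by blast
next
  case (mu n f)
  then show ?case using represents_mu by blast
qed (use represents_zero represents_succ represents_proj in blast)+


section \<open>Essential undecidability by diagonalization\<close>

text \<open>A quantifier takes the place of substituting the numeral. The sentence is equivalent to
  \<open>p\<close> at its own code, and its code arises from that of \<open>p\<close> by pairing and
  the code of a numeral alone.\<close>

definition diagonal :: "fm \<Rightarrow> fm" where
  "diagonal p = All (Imp (Eq (Var 0) (nm (replicate (fm_code p) One))) p)"

text \<open>4, 3 and 1 are the tags of \<open>All\<close>, \<open>Imp\<close> and \<open>Eq\<close>,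
  and \<open>prod_encode (0, 0)\<close> is the code of \<open>Var 0\<close>.\<close>

definition diagonal_code :: "nat \<Rightarrow> nat" where
  "diagonal_code n = prod_encode (4, prod_encode (3, prod_encode
     (prod_encode (1, prod_encode (prod_encode (0, 0), tm_code (nm (replicate n One)))), n)))"

lemma fm_code_diagonal: "fm_code (diagonal p) = diagonal_code (fm_code p)"
  by (simp add: diagonal_def diagonal_code_def)

lemma computable_diagonal_code: "computable 1 (\<lambda>xs. diagonal_code (xs ! 0))"
  unfolding diagonal_code_def
  by (intro computable_prod_encode computable_const nm_code computable_proj) simp

lemma sat_diagonal: "sat M e (diagonal p) \<longleftrightarrow> sat M (case_nat (num M (fm_code p)) e) p"
  using nm_below by (simp add: diagonal_def eval_closed)

lemma fm_below_ren: "fm_below (Suc k) (ren_fm k (\<lambda>_. 0) p)"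
proof -
  have "tm_below (Suc k) (ren_tm k (\<lambda>_. 0) t)" for k t by (induction t) auto
  then show ?thesis by (induction p arbitrary: k) auto
qed

lemma recursive_set_represented:
  assumes "computable 1 f"
  shows "\<exists>p. fm_in L p \<and> fm_below 1 p \<and>
    (\<forall>M e n. models M T \<longrightarrow> (sat M (case_nat (num M n) e) p \<longleftrightarrow> f [n] = 0))"
proof -
  obtain g where g: "recursive 1 g" "\<And>xs. length xs = 1 \<Longrightarrow> g xs = f xs"
    using assms by (auto simp: computable_def)
  obtain X where X: "represents 1 X g" using recursive_represented[OF g(1)] by blast
  \<comment> \<open>\<open>w\<close> fixes the value to 0, and all other slots hold the one
    variable. A formula defining \<open>Y\<close> may still mention other variables; renaming them
    all to index 0 removes them.\<close>
  define Y where "Y M e \<longleftrightarrow> (\<exists>w. w = num M 0 \<and> X M (case_nat w (\<lambda>_. e 0)))" for M and e :: "nat \<Rightarrow> nat"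
  have dX: "definable L X" using X by (simp add: represents_def)
  have "definable L Y"
    unfolding Y_def
    by (intro definable_intros definable_cst definable_ren[OF dX, where g = "case_nat 0 (\<lambda>_. 1)"])
      (auto split: nat.split)
  then obtain p where p: "fm_in L p" "\<And>M e. sat M e p \<longleftrightarrow> Y M e" by (auto simp: definable_def)
  have "Y M (\<lambda>_. num M n) \<longleftrightarrow> f [n] = 0" if "models M T" for M n
    using representsD[OF X that, of "[n]" "case_nat (num M 0) (\<lambda>_. num M n)"] g(2)[of "[n]"] that
    by (auto simp: Y_def)
  then show ?thesis
    using p fm_below_ren[of 0 p] by (intro exI[of _ "ren_fm 0 (\<lambda>_. 0) p"]) (simp add: sat_ren_fm)
qed

lemma models_if_extends:
  assumes "T' \<subseteq> sentences L" "theorems L T \<subseteq> theorems L T'" "models M T'"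
  shows "models M T"
proof -
  have "proves L T' p" if "p \<in> T" for p
  proof -
    have "p \<in> theorems L T" using that T by (auto simp: theorems_def sentences_def intro: proves.Assm)
    then show ?thesis using assms(2) by (auto simp: theorems_def)
  qed
  then show ?thesis using models_theorem[OF assms(3)] by (auto simp: models_def)
qed

lemma model_if_extends:
  assumes "T' \<subseteq> sentences L" "consistent L T'" "T \<subseteq> theorems L T'"
  shows "\<exists>M :: nat struct. models M T'"
proof (rule model_existence[OF assms(1,2)])
  show "tm_in L (nm (replicate i One))" for i by (rule nm_in)
  show "proves L T' (Neg (Eq (nm (replicate i One)) (nm (replicate j One))))" if "i \<noteq> j" for i j
    using distinct[of "replicate i One" "replicate j One"] that assms(3)
    by (auto simp: theorems_def)
qed

text \<open>The formula \<open>p\<close> says of \<open>n\<close> that the diagonal of the formula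
  with code \<open>n\<close> is no theorem of \<open>T'\<close>. It represents this in all models of
  \<open>T\<close>, so nothing is assumed about how \<open>T'\<close> is axiomatized.\<close>

theorem essentially_undecidable:
  assumes "consistent L T"
  shows "essentially_undecidable L T"
  unfolding essentially_undecidable_def
proof (intro conjI allI impI assms notI)
  fix T'
  assume T': "T' \<subseteq> sentences L" and ext: "theorems L T \<subseteq> theorems L T' \<and> consistent L T'"
    and "decidable_theory L T'"
  then obtain f where f: "recursive 1 f" "\<And>n. f [n] = (if n \<in> fm_code ` theorems L T' then 1 else 0)"
    by (auto simp: decidable_theory_def decidable_set_def)
  have "computable 1 (\<lambda>xs. f [xs ! 0])"
    unfolding computable_def using f(1) by (intro exI[of _ f]) (auto simp: length_Suc_conv)
  from computable_comp1[OF this computable_diagonal_code]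
  have "computable 1 (\<lambda>xs. f [diagonal_code (xs ! 0)])" .
  from recursive_set_represented[OF this] obtain p where p: "fm_in L p" "fm_below 1 p"
    and sat_p: "\<And>M e n. models M T \<Longrightarrow> sat M (case_nat (num M n) e) p \<longleftrightarrow> f [diagonal_code n] = 0"
    by auto
  have "fm_code (diagonal p) \<in> fm_code ` theorems L T' \<longleftrightarrow> diagonal p \<in> theorems L T'"
    using fm_code_inj by blast
  \<comment> \<open>The right side does not mention the model: the sentence has the same truth value
    in all models of \<open>T\<close>.\<close>
  then have sat_diag: "sat M e (diagonal p) \<longleftrightarrow> diagonal p \<notin> theorems L T'" if "models M T" for M :: "nat struct" and e
    using sat_p[OF that] f(2) by (simp add: sat_diagonal fm_code_diagonal)
  have sentence: "diagonal p \<in> sentences L"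
    using p nm_in tm_below_mono[OF nm_below] by (simp add: diagonal_def sentences_def)
  have sub: "T \<subseteq> theorems L T'"
    using ext T by (force simp: theorems_def sentences_def intro: proves.Assm)
  show False
  proof (cases "diagonal p \<in> theorems L T'")
    case True
    obtain M :: "nat struct" where M: "models M T'" using model_if_extends T' ext sub by blast
    have "sat M e (diagonal p)" for e
      using True models_theorem[OF M] by (auto simp: theorems_def)
    then show False using True sat_diag models_if_extends[OF T' _ M] ext by blast
  next
    case False
    let ?T = "insert (Neg (diagonal p)) T'"
    have "\<not> proves L T' (diagonal p)" using False sentence by (simp add: theorems_def)
    \<comment> \<open>This leads to a model of \<open>T'\<close> in which the sentence fails,
      although its unprovability makes it true in every model of \<open>T\<close>.\<close>
    then have "consistent L ?T" using proves_Raa[of L "diagonal p" T'] sentence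
      by (auto simp: sentences_def)
    moreover have "?T \<subseteq> sentences L" using T' sentence by (simp add: sentences_def)
    moreover have "T \<subseteq> theorems L ?T"
      using sub proves_mono[of L T' _ ?T] by (auto simp: theorems_def)
    ultimately obtain M :: "nat struct" where M: "models M ?T" using model_if_extends by blast
    then have "models M T'" by (simp add: models_def)
    then have "sat M e (diagonal p)" for e
      using False sat_diag models_if_extends[OF T'] ext by blast
    then show False using M by (simp add: models_def)
  qed
qed

end


section \<open>Consistency of the four theories\<close>

primrec std_fun :: "funsym \<Rightarrow> str \<Rightarrow> str" where
  "std_fun S1 x = x @ [One]"
| "std_fun S2 x = x @ [Two]"
| "std_fun S3 x = One # x"
| "std_fun S4 x = Two # x"
| "std_fun F x = rev x"

text \<open>\<open>LenLe\<close> is empty below any string other than a power of \<open>2\<close>.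
  VW7 forces this: once something lies below \<open>t\<close>, every nonempty initial segment of
  \<open>t\<close> must end in \<open>2\<close>.\<close>

primrec std_rel :: "relsym \<Rightarrow> str \<Rightarrow> str \<Rightarrow> bool" where
  "std_rel Init = prefix"
| "std_rel End = suffix"
| "std_rel LenLe = (\<lambda>x y. length x \<le> length y \<and> y = replicate (length y) Two)"

definition std :: "str struct" where
  "std = \<lparr>const_of = (\<lambda>s. s), fun_of = std_fun, rel_of = std_rel\<rparr>"

lemma std_simps [simp]: "const_of std s = s" "fun_of std = std_fun" "rel_of std = std_rel"
  by (simp_all add: std_def)

lemma std_fun_S [simp]: "std_fun (S_right d) x = x @ [d]" "std_fun (S_left d) x = d # x"
  by (cases d; simp)+

lemma eval_std_canon [simp]: "eval_tm std e (canon s) = s"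
  by (induction s rule: rev_induct) (simp_all add: canon_simps)

text \<open>With the strings written as \<open>x' @ [d]\<close> and \<open>t' @ [d]\<close>, the
  string \<open>x'\<close> is a strict initial segment of \<open>t\<close>, hence an initial segment
  of \<open>t'\<close>, and conversely.\<close>

lemma eq_if_same_strict_prefixes:
  assumes "\<forall>y. prefix y x \<and> y \<noteq> x \<longleftrightarrow> prefix y t \<and> y \<noteq> t" "suffix [d] x" "suffix [d] t"
  shows "x = t"
proof -
  obtain x' t' where *: "x = x' @ [d]" "t = t' @ [d]" using assms by (auto simp: suffix_def)
  have "prefix x' t'" using assms(1)[rule_format, of x'] * by auto
  moreover have "prefix t' x'" using assms(1)[rule_format, of t'] * by auto
  ultimately show ?thesis using * by (simp add: prefix_order.antisym)
qed

lemma eq_if_same_strict_suffixes: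
  assumes "\<forall>y. suffix y x \<and> y \<noteq> x \<longleftrightarrow> suffix y t \<and> y \<noteq> t" "prefix [d] x" "prefix [d] t"
  shows "x = t"
proof -
  obtain x' t' where *: "x = d # x'" "t = d # t'" using assms by (auto simp: prefix_def)
  have "suffix x' t'" using assms(1)[rule_format, of x'] * by (auto simp: suffix_Cons)
  moreover have "suffix t' x'" using assms(1)[rule_format, of t'] * by (auto simp: suffix_Cons)
  ultimately show ?thesis using * by (simp add: suffix_order.antisym)
qed

lemma std_common:
  "models std VW1" "models std VW2" "models std VW3" "models std VW4" "models std VW5"
  "models std VW10"
  by (auto simp: models_def VW1_def VW2_def VW3_def VW4_def VW5_def VW10_def
      prefix_order.antisym canon_simps)

lemma models_Un [simp]: "models M (A \<union> B) \<longleftrightarrow> models M A \<and> models M B"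
  by (auto simp: models_def)

lemma std_VW_plus: "models std VW_plus"
proof -
  have "models std VW6"
    by (auto simp: models_def VW6_def sat_big_dis set_strings_upto)
  moreover have "models std VW7"
  proof -
    have "prefix [Two] (rev x)" if "prefix x t" "x \<noteq> []" "t = replicate (length t) Two" for x t
    proof -
      have "last x \<in> set t" using that by (meson last_in_set set_mono_prefix subsetD)
      then have "last x = Two" using that(3) by (metis in_set_replicate)
      then have "x = butlast x @ [Two]" using that(2) by (metis append_butlast_last_id)
      then show ?thesis by (metis rev.simps(2) rev_rev_ident prefix_def rev_append rev_singleton_conv append_Cons append_Nil)
    qed
    then show ?thesis by (auto simp: models_def VW7_def canon_simps)
  qed
  moreover have "models std VW8" "models std VW9"
    by (auto simp: models_def VW8_def VW9_def)
  ultimately show ?thesis using std_common by (simp add: VW_plus_def)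
qed

lemma std_VW_star: "models std VW_star"
proof -
  have "models std VW2_star" "models std VW3_star" "models std VW4_star" "models std VW5_star"
    by (auto simp: models_def VW2_star_def VW3_star_def VW4_star_def VW5_star_def suffix_Cons canon_simps)
  then show ?thesis using std_common by (simp add: VW_star_def)
qed

lemma std_VW0_1: "models std VW0_1"
  by (auto simp: models_def VW0_1_def)

lemma std_VW0_2: "models std VW0_2"
  by (auto simp: models_def VW0_2_def sat_big_dis)

lemma std_VW_0: "models std VW_0"
proof -
  have "models std VW0_3" by (auto simp: models_def VW0_3_def sat_big_dis)
  moreover have "models std VW0_4"
    by (auto simp: models_def VW0_4_def VW0_4_conj_def Proper_def)
      (metis eq_if_same_strict_prefixes)+
  moreover have "models std VW0_5"
    by (auto simp: models_def VW0_5_def VW0_5_conj_def Proper_def)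
      (metis eq_if_same_strict_suffixes)+
  ultimately show ?thesis using std_common std_VW0_1 std_VW0_2 by (simp add: VW_0_def)
qed

lemma std_VWDI: "models std VWDI"
proof -
  have "models std VWDI_2" "models std VWDI_4" by (auto simp: models_def VWDI_2_def VWDI_4_def)
  moreover have "models std VWDI_5"
  proof -
    have "prefix [d] (rev x) \<longleftrightarrow> suffix [d] x" for d :: digit and x by (simp add: suffix_to_prefix)
    then show ?thesis
      by (auto simp: models_def VWDI_5_def VWDI_5_conj_def Proper_def)
        (metis eq_if_same_strict_prefixes)+
  qed
  ultimately show ?thesis using std_common std_VW0_1 std_VW0_2 by (simp add: VWDI_def)
qed


section \<open>The four theories as string theories\<close>

lemma computable_code_Const: "computable 1 (\<lambda>xs. tm_code (Const (replicate (xs ! 0) One)))"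
proof -
  have "computable 1 (\<lambda>xs. Suc (prod_encode (1, xs ! 0)))"
    by (intro computable_Suc computable_prod_encode computable_const computable_proj) simp
  from computable_iterate[OF this, of 0]
  have "computable 1 (\<lambda>xs. list_encode (replicate (xs ! 0) 1))"
  proof (rule computable_cong)
    have "rec_nat 0 (\<lambda>_ r. Suc (prod_encode (1, r))) n = list_encode (replicate n 1)" for n
      by (induction n) auto
    then show "rec_nat 0 (\<lambda>_ r. Suc (prod_encode (1, r))) (xs ! 0) = list_encode (replicate (xs ! 0) 1)"
      for xs :: "nat list" by simp
  qed
  then show ?thesis by (simp add: computable_prod_encode computable_const)
qed

lemma computable_code_canon: "computable 1 (\<lambda>xs. tm_code (canon (replicate (xs ! 0) One)))"
proof -
  have "computable 1 (\<lambda>xs. prod_encode (2, prod_encode (0, xs ! 0)))"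
    by (intro computable_prod_encode computable_const computable_proj) simp
  from computable_iterate[OF this, of "tm_code (Const [])"] show ?thesis
  proof (rule computable_cong)
    have "rec_nat (tm_code (Const [])) (\<lambda>_ r. prod_encode (2, prod_encode (0, r))) n =
        tm_code (canon (replicate n One))" for n
    proof (induction n)
      case (Suc n)
      have "canon (replicate (Suc n) One) = App S1 (canon (replicate n One))"
        using canon_simps(2)[of "replicate n One" One] by (simp add: replicate_append_same)
      then show ?case using Suc by simp
    qed (simp add: canon_simps)
    then show "rec_nat (tm_code (Const [])) (\<lambda>_ r. prod_encode (2, prod_encode (0, r))) (xs ! 0) =
        tm_code (canon (replicate (xs ! 0) One))" for xs :: "nat list" by simp
  qed
qed

lemma modelsD: "models M T \<Longrightarrow> p \<in> T \<Longrightarrow> sat M e p"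
  by (simp add: models_def)

text \<open>\<open>le\<close> is \<open>prefix\<close> or \<open>suffix\<close>, and \<open>q z\<close> says which digit was added to obtain \<open>z\<close>.\<close>

lemma definable_successor_iff:
  assumes c: "\<And>s t. c s = c t \<longleftrightarrow> s = t"
    and P: "\<And>x u. P x (c u) \<longleftrightarrow> (\<exists>v. le v u \<and> x = c v)"
    and le: "\<And>v. le v t \<longleftrightarrow> le v s \<or> v = t" "\<not> le t s" "le s s"
    and q: "q (c t)"
    and ax: "\<And>x. \<forall>y. P y x \<and> y \<noteq> x \<longleftrightarrow> P y (c t) \<and> y \<noteq> c t \<Longrightarrow> q x \<Longrightarrow> x = c t"
  shows "P (c s) z \<and> (\<forall>y. P y z \<and> \<not> y = z \<longleftrightarrow> P y (c s)) \<and> q z \<longleftrightarrow> z = c t"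
proof
  have Ps: "P (c s) (c t)" unfolding P using le by blast
  have strict: "P y (c t) \<and> y \<noteq> c t \<longleftrightarrow> P y (c s)" for y
    unfolding P using le c by auto
  \<comment> \<open>\<open>z\<close> and \<open>c t\<close> have the same strict segments, so
    \<open>ax\<close> identifies them.\<close>
  show "z = c t" if "P (c s) z \<and> (\<forall>y. P y z \<and> \<not> y = z \<longleftrightarrow> P y (c s)) \<and> q z"
    using that strict by (intro ax) auto
  show "P (c s) z \<and> (\<forall>y. P y z \<and> \<not> y = z \<longleftrightarrow> P y (c s)) \<and> q z" if "z = c t"
    using Ps strict q that by simp
qed

section \<open>The theories with a constant for each string\<close>

text \<open>Adding \<open>d\<close> to \<open>x\<close> is recognized from the strict segments of
  \<open>z\<close> and its digit at the other end; VW0_4 and VW0_5 make \<open>z\<close> unique when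
  \<open>x\<close> is standard. The conjunct \<open>?P M x z\<close> secures \<open>R_P\<close> also
  at elements where reflexivity is not known.\<close>

lemma essentially_undecidable_VW_0: "essentially_undecidable L_VW_0 VW_0"
proof -
  let ?P = "\<lambda>M :: nat struct. rel_of M Init" and ?Q = "\<lambda>M :: nat struct. rel_of M End"
  let ?R = "\<lambda>d (M :: nat struct) x z. ?P M x z \<and> (\<forall>y. ?P M y z \<and> \<not> y = z \<longleftrightarrow> ?P M y x) \<and>
      ?Q M (const_of M [d]) z"
  let ?Lf = "\<lambda>d (M :: nat struct) x z. ?Q M x z \<and> (\<forall>y. ?Q M y z \<and> \<not> y = z \<longleftrightarrow> ?Q M y x) \<and>
      ?P M (const_of M [d]) z"
  have in_lang: "Init \<in> rels_of L_VW_0" "End \<in> rels_of L_VW_0" "consts_of L_VW_0 = UNIV"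
    by (auto simp: L_VW_0_def)
  have P: "definable L_VW_0 (\<lambda>M e. ?P M (e i) (e j))" for i j
    using definable_rel[of Init L_VW_0 "Var i" "Var j"] in_lang by simp
  have Q: "definable L_VW_0 (\<lambda>M e. ?Q M (e i) (e j))" for i j
    using definable_rel[of End L_VW_0 "Var i" "Var j"] in_lang by simp
  have Pd: "definable L_VW_0 (\<lambda>M e. ?P M (const_of M [d]) (e j))" for d j
    using definable_rel[of Init L_VW_0 "Const [d]" "Var j"] in_lang by simp
  have Qd: "definable L_VW_0 (\<lambda>M e. ?Q M (const_of M [d]) (e j))" for d j
    using definable_rel[of End L_VW_0 "Const [d]" "Var j"] in_lang by simp
  have val: "value_of M (Const s) = const_of M s" for M :: "nat struct" and s
    by (simp add: value_of_def)
  have distinct: "const_of M s = const_of M t \<longleftrightarrow> s = t" if "models M VW_0" for M :: "nat struct" and s t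
  proof -
    have "sat M undefined (Neg (Eq (Const s) (Const t)))" if "s \<noteq> t"
      using \<open>models M VW_0\<close> by (rule modelsD) (use that in \<open>auto simp: VW_0_def VW0_1_def\<close>)
    then show ?thesis by auto
  qed
  have P_iff: "?P M x (const_of M t) \<longleftrightarrow> (\<exists>s. prefix s t \<and> x = const_of M s)"
    if "models M VW_0" for M x t
  proof -
    have "sat M undefined (All (Iff (Rel Init (Var 0) (Const t))
        (big_dis (map (\<lambda>s. Eq (Var 0) (Const s)) (prefixes t)))))"
      using that by (rule modelsD) (auto simp: VW_0_def VW0_2_def)
    then show ?thesis by (simp add: sat_big_dis) (metis in_set_prefixes)
  qed
  have Q_iff: "?Q M x (const_of M t) \<longleftrightarrow> (\<exists>s. suffix s t \<and> x = const_of M s)"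
    if "models M VW_0" for M x t
  proof -
    have "sat M undefined (All (Iff (Rel End (Var 0) (Const t))
        (big_dis (map (\<lambda>s. Eq (Var 0) (Const s)) (suffixes t)))))"
      using that by (rule modelsD) (auto simp: VW_0_def VW0_3_def)
    then show ?thesis by (simp add: sat_big_dis) (metis in_set_suffixes)
  qed
  have R_iff: "?R d M (const_of M s) z \<longleftrightarrow> z = const_of M (s @ [d])" if M: "models M VW_0" for d M s z
  proof (rule definable_successor_iff[of "const_of M" "?P M" prefix "s @ [d]" s "?Q M (const_of M [d])"])
    fix x
    assume *: "\<forall>y. ?P M y x \<and> y \<noteq> x \<longleftrightarrow> ?P M y (const_of M (s @ [d])) \<and> y \<noteq> const_of M (s @ [d])"
      "?Q M (const_of M [d]) x"
    have d: "?Q M (const_of M [d]) (const_of M (s @ [d]))" using Q_iff[OF M] by (auto simp: suffix_def)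
    have "sat M (\<lambda>_. undefined) (All (Imp
        (All (Iff (Proper Init (Var 0) (Var 1)) (Proper Init (Var 0) (Const (s @ [d])))))
        (Con (VW0_4_conj (s @ [d]) One) (VW0_4_conj (s @ [d]) Two))))"
      using M by (rule modelsD) (auto simp: VW_0_def VW0_4_def)
    then have "sat M (case_nat x (\<lambda>_. undefined)) (Imp
        (All (Iff (Proper Init (Var 0) (Var 1)) (Proper Init (Var 0) (Const (s @ [d])))))
        (Con (VW0_4_conj (s @ [d]) One) (VW0_4_conj (s @ [d]) Two)))"
      by (simp only: sat.simps(5))
    then show "x = const_of M (s @ [d])"
      using * d by (cases d) (auto simp: Proper_def VW0_4_conj_def)
  qed (use distinct[OF M] P_iff[OF M] Q_iff[OF M] in \<open>auto simp: suffix_def prefix_snoc dest: prefix_length_le\<close>)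
  have Lf_iff: "?Lf d M (const_of M s) z \<longleftrightarrow> z = const_of M (d # s)" if M: "models M VW_0" for d M s z
  proof (rule definable_successor_iff[of "const_of M" "?Q M" suffix "d # s" s "?P M (const_of M [d])"])
    fix x
    assume *: "\<forall>y. ?Q M y x \<and> y \<noteq> x \<longleftrightarrow> ?Q M y (const_of M (d # s)) \<and> y \<noteq> const_of M (d # s)"
      "?P M (const_of M [d]) x"
    have d: "?P M (const_of M [d]) (const_of M (d # s))"
      by (simp add: P_iff[OF M] distinct[OF M])
    have "sat M (\<lambda>_. undefined) (All (Imp
        (All (Iff (Proper End (Var 0) (Var 1)) (Proper End (Var 0) (Const (d # s)))))
        (Con (VW0_5_conj (d # s) One) (VW0_5_conj (d # s) Two))))"
      using M by (rule modelsD) (auto simp: VW_0_def VW0_5_def)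
    then have "sat M (case_nat x (\<lambda>_. undefined)) (Imp
        (All (Iff (Proper End (Var 0) (Var 1)) (Proper End (Var 0) (Const (d # s)))))
        (Con (VW0_5_conj (d # s) One) (VW0_5_conj (d # s) Two)))"
      by (simp only: sat.simps(5))
    then show "x = const_of M (d # s)"
      using * d by (cases d) (auto simp: Proper_def VW0_5_conj_def)
  qed (use distinct[OF M] P_iff[OF M] Q_iff[OF M] in \<open>auto simp: suffix_Cons dest: suffix_length_le\<close>)
  interpret string_theory L_VW_0 VW_0 Const ?P ?Q ?R ?Lf
  proof
    show "VW_0 \<subseteq> sentences L_VW_0" by (rule theories_are_sentences)
    show "definable L_VW_0 (\<lambda>M e. ?R d M (e i) (e j))" for d i j
      by (intro definable_intros P Qd definable_eq_var)
    show "definable L_VW_0 (\<lambda>M e. ?Lf d M (e i) (e j))" for d i j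
      by (intro definable_intros Q Pd definable_eq_var)
    show "Neg (Eq (Const s) (Const t)) \<in> VW_0" if "s \<noteq> t" for s t
      using that by (auto simp: VW_0_def VW0_1_def)
  qed (use P Q P_iff Q_iff R_iff Lf_iff computable_code_Const in_lang in \<open>simp_all add: val\<close>)
  show ?thesis using models_imp_consistent[OF std_VW_0] by (rule essentially_undecidable)
qed

text \<open>With a reversal \<open>f\<close>, end segments and left successors are the mirror images of initial
  segments and right successors.\<close>

lemma reversal_suffix_iff:
  assumes "inj f" "\<And>s. f (c s) = c (rev s)" "\<And>x t. P x (c t) \<longleftrightarrow> (\<exists>s. prefix s t \<and> x = c s)"
  shows "P (f x) (f (c t)) \<longleftrightarrow> (\<exists>s. suffix s t \<and> x = c s)"
proof -
  have "P (f x) (f (c t)) \<longleftrightarrow> (\<exists>s. prefix s (rev t) \<and> f x = f (c (rev s)))"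
    by (simp add: assms(2,3))
  \<comment> \<open>Injectivity rules out a nonstandard \<open>x\<close> whose reversal is
    standard.\<close>
  also have "\<dots> \<longleftrightarrow> (\<exists>s. suffix (rev s) t \<and> x = c (rev s))"
    using assms(1) by (simp add: inj_eq suffix_to_prefix)
  also have "\<dots> \<longleftrightarrow> (\<exists>s. suffix s t \<and> x = c s)" by (metis rev_rev_ident)
  finally show ?thesis .
qed

lemma reversal_left_iff:
  assumes "inj f" "\<And>s. f (c s) = c (rev s)" "\<And>s y. R (c s) y \<longleftrightarrow> y = c (s @ [d])"
  shows "R (f (c s)) (f y) \<longleftrightarrow> y = c (d # s)"
proof -
  \<comment> \<open>Here \<open>rev (d # s)\<close> is \<open>rev s @ [d]\<close>.\<close>
  have "R (f (c s)) (f y) \<longleftrightarrow> f y = f (c (d # s))" by (simp add: assms(2,3))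
  then show ?thesis using assms(1) by (simp add: inj_eq)
qed

text \<open>The added digit is tested at the front of \<open>f z\<close>, which replaces the missing
  end segments. In \<open>?Lf\<close> the test reaches \<open>f (f z)\<close>, that is, the front of
  \<open>z\<close>. Injectivity of \<open>f\<close> comes from its being an involution.\<close>

lemma essentially_undecidable_VWDI: "essentially_undecidable L_VWDI VWDI"
proof -
  let ?P = "\<lambda>M :: nat struct. rel_of M Init" and ?f = "\<lambda>M :: nat struct. fun_of M F"
  let ?Q = "\<lambda>M x y. ?P M (?f M x) (?f M y)"
  let ?R = "\<lambda>d (M :: nat struct) x z. ?P M x z \<and> (\<forall>y. ?P M y z \<and> \<not> y = z \<longleftrightarrow> ?P M y x) \<and>
      ?P M (const_of M [d]) (?f M z)"
  let ?Lf = "\<lambda>d M x z. ?R d M (?f M x) (?f M z)"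
  have in_lang: "Init \<in> rels_of L_VWDI" "F \<in> funs_of L_VWDI" "consts_of L_VWDI = UNIV"
    by (auto simp: L_VWDI_def)
  have P: "definable L_VWDI (\<lambda>M e. ?P M (e i) (e j))" for i j
    using definable_rel[of Init L_VWDI "Var i" "Var j"] in_lang by simp
  have Pf: "definable L_VWDI (\<lambda>M e. ?P M (e i) (?f M (e j)))" for i j
    using definable_rel[of Init L_VWDI "Var i" "App F (Var j)"] in_lang by simp
  have Q: "definable L_VWDI (\<lambda>M e. ?Q M (e i) (e j))" for i j
    using definable_rel[of Init L_VWDI "App F (Var i)" "App F (Var j)"] in_lang by simp
  have Pd: "definable L_VWDI (\<lambda>M e. ?P M (const_of M [d]) (?f M (e j)))" for d j
    using definable_rel[of Init L_VWDI "Const [d]" "App F (Var j)"] in_lang by simp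
  have Pdd: "definable L_VWDI (\<lambda>M e. ?P M (const_of M [d]) (?f M (?f M (e j))))" for d j
    using definable_rel[of Init L_VWDI "Const [d]" "App F (App F (Var j))"] in_lang by simp
  have eq_f: "definable L_VWDI (\<lambda>M e. e i = ?f M (e j))" for i j
    using definable_eq[of L_VWDI "Var i" "App F (Var j)"] in_lang by simp
  have val: "value_of M (Const s) = const_of M s" for M :: "nat struct" and s
    by (simp add: value_of_def)
  have distinct: "const_of M s = const_of M t \<longleftrightarrow> s = t" if "models M VWDI" for M :: "nat struct" and s t
  proof -
    have "sat M undefined (Neg (Eq (Const s) (Const t)))" if "s \<noteq> t"
      using \<open>models M VWDI\<close> by (rule modelsD) (use that in \<open>auto simp: VWDI_def VW0_1_def\<close>)
    then show ?thesis by auto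
  qed
  have inj: "inj (?f M)" if "models M VWDI" for M
  proof -
    have "sat M undefined (All (Eq (App F (App F (Var 0))) (Var 0)))"
      using that by (rule modelsD) (auto simp: VWDI_def VWDI_4_def)
    then show ?thesis by (intro inj_on_inverseI[of _ "?f M"]) simp
  qed
  have f: "?f M (const_of M s) = const_of M (rev s)" if "models M VWDI" for M s
  proof -
    have "sat M undefined (Eq (App F (Const s)) (Const (rev s)))"
      using that by (rule modelsD) (auto simp: VWDI_def VWDI_2_def)
    then show ?thesis by simp
  qed
  have P_iff: "?P M x (const_of M t) \<longleftrightarrow> (\<exists>s. prefix s t \<and> x = const_of M s)"
    if "models M VWDI" for M x t
  proof -
    have "sat M undefined (All (Iff (Rel Init (Var 0) (Const t))
        (big_dis (map (\<lambda>s. Eq (Var 0) (Const s)) (prefixes t)))))"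
      using that by (rule modelsD) (auto simp: VWDI_def VW0_2_def)
    then show ?thesis by (simp add: sat_big_dis) (metis in_set_prefixes)
  qed
  have R_iff: "?R d M (const_of M s) z \<longleftrightarrow> z = const_of M (s @ [d])" if M: "models M VWDI" for d M s z
  proof (rule definable_successor_iff[of "const_of M" "?P M" prefix "s @ [d]" s
        "\<lambda>z. ?P M (const_of M [d]) (?f M z)"])
    fix x
    assume *: "\<forall>y. ?P M y x \<and> y \<noteq> x \<longleftrightarrow> ?P M y (const_of M (s @ [d])) \<and> y \<noteq> const_of M (s @ [d])"
      "?P M (const_of M [d]) (?f M x)"
    have d: "?P M (const_of M [d]) (?f M (const_of M (s @ [d])))"
      by (simp add: P_iff[OF M] f[OF M] distinct[OF M])
    have "sat M (\<lambda>_. undefined) (All (Imp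
        (All (Iff (Proper Init (Var 0) (Var 1)) (Proper Init (Var 0) (Const (s @ [d])))))
        (Con (VWDI_5_conj (s @ [d]) One) (VWDI_5_conj (s @ [d]) Two))))"
      using M by (rule modelsD) (auto simp: VWDI_def VWDI_5_def)
    then have "sat M (case_nat x (\<lambda>_. undefined)) (Imp
        (All (Iff (Proper Init (Var 0) (Var 1)) (Proper Init (Var 0) (Const (s @ [d])))))
        (Con (VWDI_5_conj (s @ [d]) One) (VWDI_5_conj (s @ [d]) Two)))"
      by (simp only: sat.simps(5))
    then show "x = const_of M (s @ [d])"
      using * d by (cases d) (auto simp: Proper_def VWDI_5_conj_def)
  qed (use distinct[OF M] P_iff[OF M] f[OF M] in \<open>auto simp: prefix_snoc dest: prefix_length_le\<close>)
  interpret string_theory L_VWDI VWDI Const ?P ?Q ?R ?Lf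
  proof
    show "VWDI \<subseteq> sentences L_VWDI" by (rule theories_are_sentences)
    show "definable L_VWDI (\<lambda>M e. ?R d M (e i) (e j))" for d i j
      by (intro definable_intros P Pd definable_eq_var)
    show "definable L_VWDI (\<lambda>M e. ?Lf d M (e i) (e j))" for d i j
      by (intro definable_intros Q Pf Pdd eq_f)
    show "Neg (Eq (Const s) (Const t)) \<in> VWDI" if "s \<noteq> t" for s t
      using that by (auto simp: VWDI_def VW0_1_def)
    show "?Q M x (value_of M (Const t)) \<longleftrightarrow> (\<exists>s. suffix s t \<and> x = value_of M (Const s))"
      if "models M VWDI" for M x t
      unfolding val using inj[OF that] f[OF that] P_iff[OF that] by (rule reversal_suffix_iff)
    show "?Lf d M (value_of M (Const s)) y \<longleftrightarrow> y = value_of M (Const (d # s))"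
      if "models M VWDI" for d M s y
      unfolding val using inj[OF that] f[OF that] R_iff[OF that]
      by (rule reversal_left_iff[where R = "?R d M"])
  qed (use P Q P_iff R_iff computable_code_Const in_lang in \<open>simp_all add: val\<close>)
  show ?thesis using models_imp_consistent[OF std_VWDI] by (rule essentially_undecidable)
qed

section \<open>The theories with canonical terms\<close>

text \<open>VW3 and VW4 settle the empty string, and VW5 is the induction step at the right end;
  together they exclude nonstandard initial segments of a standard string.\<close>

lemma canonical_prefix_iff:
  assumes "models M (VW3 \<union> VW4 \<union> VW5)"
  shows "rel_of M Init x (value_of M (canon t)) \<longleftrightarrow> (\<exists>s. prefix s t \<and> x = value_of M (canon s))"
proof (induction t rule: rev_induct)
  case Nil
  have "sat M (\<lambda>_. undefined) (Rel Init (canon []) (canon []))"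
    "sat M (\<lambda>_. undefined) (All (Imp (Rel Init (Var 0) (canon [])) (Eq (Var 0) (canon []))))"
    using assms by (auto simp: models_def VW3_def VW4_def simp del: sat.simps)
  then show ?case by (auto simp: value_of_def canon_simps)
next
  case (snoc d t)
  \<comment> \<open>Any language with the symbols of canonical terms would do; only closedness is
    extracted.\<close>
  have closed: "eval_tm M e (canon t) = value_of M (canon t)" for e
    using canon_closed[of "\<lparr>consts_of = {[]}, funs_of = {S1, S2}, rels_of = {}\<rparr>"]
    by (intro eval_closed) simp
  have "sat M (\<lambda>_. undefined) (All (Iff (Rel Init (Var 0) (App (S_right d) (canon t)))
      (Dis (Rel Init (Var 0) (canon t)) (Eq (Var 0) (App (S_right d) (canon t))))))"
    using assms by (auto simp: models_def VW5_def simp del: sat.simps)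
  moreover have "value_of M (canon (t @ [d])) = fun_of M (S_right d) (value_of M (canon t))"
    by (simp add: value_of_def canon_simps)
  ultimately show ?case using snoc by (auto simp: closed prefix_snoc)
qed

lemma value_of_canon_snoc:
  "value_of M (canon (s @ [d])) = fun_of M (S_right d) (value_of M (canon s))"
  by (simp add: value_of_def canon_simps)

lemma S_in_lang:
  "S_right d \<in> funs_of L_VW_plus" "S_right d \<in> funs_of L_VW_star" "S_left d \<in> funs_of L_VW_star"
  by (cases d; simp add: L_VW_plus_def L_VW_star_def)+

lemma canon_in_lang: "tm_in L_VW_plus (canon s)" "tm_in L_VW_star (canon s)" "tm_below n (canon s)"
  using canon_closed[of L_VW_plus s n] canon_closed[of L_VW_star s n]
  by (auto simp: L_VW_plus_def L_VW_star_def)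

text \<open>\<open>S_right d\<close> alone would not do for \<open>?R\<close>, as it might map a
  nonstandard element to a standard one; the conjunct \<open>?P M x z\<close> excludes such an
  \<open>x\<close>. VW9 carries everything over to the left side.\<close>

lemma essentially_undecidable_VW_plus: "essentially_undecidable L_VW_plus VW_plus"
proof -
  let ?P = "\<lambda>M :: nat struct. rel_of M Init" and ?f = "\<lambda>M :: nat struct. fun_of M F"
  let ?Q = "\<lambda>M x y. ?P M (?f M x) (?f M y)"
  let ?R = "\<lambda>d (M :: nat struct) x z. z = fun_of M (S_right d) x \<and> ?P M x z"
  let ?Lf = "\<lambda>d M x z. ?R d M (?f M x) (?f M z)"
  let ?c = "\<lambda>M s. value_of M (canon s)"
  have in_lang: "Init \<in> rels_of L_VW_plus" "F \<in> funs_of L_VW_plus"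
    by (auto simp: L_VW_plus_def)
  have P: "definable L_VW_plus (\<lambda>M e. ?P M (e i) (e j))" for i j
    using definable_rel[of Init L_VW_plus "Var i" "Var j"] in_lang by simp
  have Q: "definable L_VW_plus (\<lambda>M e. ?Q M (e i) (e j))" for i j
    using definable_rel[of Init L_VW_plus "App F (Var i)" "App F (Var j)"] in_lang by simp
  have S: "definable L_VW_plus (\<lambda>M e. e j = fun_of M (S_right d) (e i))" for i j d
    using definable_eq[of L_VW_plus "Var j" "App (S_right d) (Var i)"] S_in_lang by simp
  have Sf: "definable L_VW_plus (\<lambda>M e. ?f M (e j) = fun_of M (S_right d) (?f M (e i)))" for i j d
    using definable_eq[of L_VW_plus "App F (Var j)" "App (S_right d) (App F (Var i))"]
      S_in_lang in_lang by simp
  have inj: "inj (?f M)" if "models M VW_plus" for M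
  proof -
    have "sat M undefined (All (All (Imp (Eq (App F (Var 1)) (App F (Var 0))) (Eq (Var 1) (Var 0)))))"
      using that by (rule modelsD) (auto simp: VW_plus_def VW9_def)
    then show ?thesis by (auto intro: injI)
  qed
  have f: "?f M (?c M s) = ?c M (rev s)" if "models M VW_plus" for M s
  proof -
    have "sat M (\<lambda>_. undefined) (Eq (App F (canon s)) (canon (rev s)))"
      using that by (rule modelsD) (auto simp: VW_plus_def VW8_def)
    then show ?thesis by (simp add: value_of_def)
  qed
  have P_iff: "?P M x (?c M t) \<longleftrightarrow> (\<exists>s. prefix s t \<and> x = ?c M s)" if "models M VW_plus" for M x t
    using that by (intro canonical_prefix_iff) (simp add: VW_plus_def)
  have R_iff: "?R d M (?c M s) z \<longleftrightarrow> z = ?c M (s @ [d])" if "models M VW_plus" for d M s z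
    using P_iff[OF that, of "?c M s" "s @ [d]"] by (auto simp: value_of_canon_snoc)
  interpret string_theory L_VW_plus VW_plus canon ?P ?Q ?R ?Lf
  proof
    show "VW_plus \<subseteq> sentences L_VW_plus" by (rule theories_are_sentences)
    show "definable L_VW_plus (\<lambda>M e. ?R d M (e i) (e j))" for d i j
      by (intro definable_intros P S)
    show "definable L_VW_plus (\<lambda>M e. ?Lf d M (e i) (e j))" for d i j
      by (intro definable_intros Q Sf)
    show "Neg (Eq (canon s) (canon t)) \<in> VW_plus" if "s \<noteq> t" for s t
      using that by (auto simp: VW_plus_def VW1_def)
    show "?Q M x (?c M t) \<longleftrightarrow> (\<exists>s. suffix s t \<and> x = ?c M s)" if "models M VW_plus" for M x t
      using inj[OF that] f[OF that] P_iff[OF that] by (rule reversal_suffix_iff)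
    show "?Lf d M (?c M s) y \<longleftrightarrow> y = ?c M (d # s)" if "models M VW_plus" for d M s y
      using inj[OF that] f[OF that] R_iff[OF that]
      by (rule reversal_left_iff[where R = "?R d M"])
    show "?Q M x y" if "?Lf d M x y" for d M x y using that by blast
  qed (use P Q P_iff R_iff computable_code_canon canon_in_lang in \<open>simp_all\<close>)
  show ?thesis using models_imp_consistent[OF std_VW_plus] by (rule essentially_undecidable)
qed

text \<open>Canonical terms grow at the right, whereas VW5_star describes growth at the left.
  VW2_star links the two, so the end segments can be found by induction from the left.\<close>

lemma essentially_undecidable_VW_star: "essentially_undecidable L_VW_star VW_star"
proof -
  let ?P = "\<lambda>M :: nat struct. rel_of M Init" and ?Q = "\<lambda>M :: nat struct. rel_of M End"
  let ?R = "\<lambda>d (M :: nat struct) x z. z = fun_of M (S_right d) x \<and> ?P M x z"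
  let ?Lf = "\<lambda>d (M :: nat struct) x z. z = fun_of M (S_left d) x \<and> ?Q M x z"
  let ?c = "\<lambda>M s. value_of M (canon s)"
  have in_lang: "Init \<in> rels_of L_VW_star" "End \<in> rels_of L_VW_star"
    by (auto simp: L_VW_star_def)
  have P: "definable L_VW_star (\<lambda>M e. ?P M (e i) (e j))" for i j
    using definable_rel[of Init L_VW_star "Var i" "Var j"] in_lang by simp
  have Q: "definable L_VW_star (\<lambda>M e. ?Q M (e i) (e j))" for i j
    using definable_rel[of End L_VW_star "Var i" "Var j"] in_lang by simp
  have S: "definable L_VW_star (\<lambda>M e. e j = fun_of M (S_right d) (e i))"
    "definable L_VW_star (\<lambda>M e. e j = fun_of M (S_left d) (e i))" for i j d
    using definable_eq[of L_VW_star "Var j" "App (S_right d) (Var i)"]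
      definable_eq[of L_VW_star "Var j" "App (S_left d) (Var i)"] S_in_lang by simp_all
  have P_iff: "?P M x (?c M t) \<longleftrightarrow> (\<exists>s. prefix s t \<and> x = ?c M s)" if "models M VW_star" for M x t
    using that by (intro canonical_prefix_iff) (simp add: VW_star_def)
  have Cons: "?c M (d # t) = fun_of M (S_left d) (?c M t)" if "models M VW_star" for M d t
  proof -
    have "sat M (\<lambda>_. undefined) (Eq (App (S_left d) (canon t)) (canon (d # t)))"
      using that by (rule modelsD) (auto simp: VW_star_def VW2_star_def)
    then show ?thesis by (simp add: value_of_def)
  qed
  have Q_iff: "?Q M x (?c M t) \<longleftrightarrow> (\<exists>s. suffix s t \<and> x = ?c M s)" if M: "models M VW_star" for M x t
  proof (induction t)
    case Nil
    have "sat M (\<lambda>_. undefined) (Rel End (canon []) (canon []))"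
      using M by (rule modelsD) (auto simp: VW_star_def VW3_star_def)
    moreover have "sat M (\<lambda>_. undefined)
        (All (Imp (Rel End (Var 0) (canon [])) (Eq (Var 0) (canon []))))"
      using M by (rule modelsD) (auto simp: VW_star_def VW4_star_def)
    ultimately show ?case by (auto simp: value_of_def canon_simps)
  next
    case (Cons d t)
    have "sat M (\<lambda>_. undefined) (All (Iff (Rel End (Var 0) (App (S_left d) (canon t)))
        (Dis (Rel End (Var 0) (canon t)) (Eq (Var 0) (App (S_left d) (canon t))))))"
      using M by (rule modelsD) (auto simp: VW_star_def VW5_star_def)
    then show ?case
      using Cons.IH \<open>\<And>M d t. models M VW_star \<Longrightarrow> ?c M (d # t) = fun_of M (S_left d) (?c M t)\<close>[OF M]
      by (auto simp: eval_closed canon_in_lang suffix_Cons)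
  qed
  have R_iff: "?R d M (?c M s) z \<longleftrightarrow> z = ?c M (s @ [d])" if "models M VW_star" for d M s z
    using P_iff[OF that, of "?c M s" "s @ [d]"] by (auto simp: value_of_canon_snoc)
  have Lf_iff: "?Lf d M (?c M s) z \<longleftrightarrow> z = ?c M (d # s)" if "models M VW_star" for d M s z
    using Q_iff[OF that, of "?c M s" "d # s"] by (auto simp: Cons[OF that] suffix_Cons)
  interpret string_theory L_VW_star VW_star canon ?P ?Q ?R ?Lf
  proof
    show "VW_star \<subseteq> sentences L_VW_star" by (rule theories_are_sentences)
    show "definable L_VW_star (\<lambda>M e. ?R d M (e i) (e j))" for d i j
      by (intro definable_intros P S)
    show "definable L_VW_star (\<lambda>M e. ?Lf d M (e i) (e j))" for d i j
      by (intro definable_intros Q S)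
    show "Neg (Eq (canon s) (canon t)) \<in> VW_star" if "s \<noteq> t" for s t
      using that by (auto simp: VW_star_def VW1_def)
  qed (use P Q P_iff Q_iff R_iff Lf_iff computable_code_canon canon_in_lang in \<open>simp_all\<close>)
  show ?thesis using models_imp_consistent[OF std_VW_star] by (rule essentially_undecidable)
qed

theorem mainTheorem4:
  shows "essentially_undecidable L_VW_plus VW_plus
    \<and> essentially_undecidable L_VW_star VW_star
    \<and> essentially_undecidable L_VW_0 VW_0
    \<and> essentially_undecidable L_VWDI VWDI"
  using essentially_undecidable_VW_plus essentially_undecidable_VW_star
    essentially_undecidable_VW_0 essentially_undecidable_VWDI by blast

end
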